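(* Let $m>n\ge t\geq 2$ and let $F=(F_{ij})$ be an $m\times n$ matrix with entries in $\mathbb{C}\{x_1,\dots,x_N\}$ defining a determinantal singularity $(X,0)=(F^{-1}(M_{m,n}^t),0)\subset(\mathbb{C}^N,0)$ of type $(m,n,t)$ with finite $\mathcal{G}$-Tjurina number $\tau=\tau_{\mathcal G}$. Assume $\dim X\ge m$. Let $F_u$, $u\in(\mathbb{C}^{\tau},0)$, be the $\mathcal{G}$-versal unfolding of $F$, and let $X_u=F_u^{-1}(M_{m,n}^t)$ be the fibres (in a sufficiently small representative) of the $\mathcal{G}$-versal family of $(X,0)$, with Tjurina transforms $\pi_u:Y_u\to X_u$. Let $D$ be the discriminant of this family, i.e. the set of all $u$ in the base for which $X_u$ is singular. Then $D$ decomposes as $D=D_A\cup D_B$, where (A) $D_A$ is the set of points $u$ of the base above which there are determinantal singularities, i.e. such that there is a point $x\in X_u$ with $\operatorname{rk}F_u(x)<t-1$; (B) $D_B$ is the set of points $u$ of the base above which there are singularities leading to singular points in the Tjurina transform, i.e. such that there is a singular point $x\in X_u$ and a point $y\in\pi_u^{-1}(x)$ at which $Y_u$ is singular.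
   Context: $M_{m,n}\cong\mathbb{C}^{mn}$ denotes the space of complex $m\times n$ matrices and $M_{m,n}^t=\{A\in M_{m,n}: \operatorname{rk}A<t\}$, with scheme structure given by the ideal of $t$-minors of the generic $m\times n$ matrix. A germ $X=F^{-1}(M_{m,n}^t)\subset(\mathbb{C}^N,0)$ (defined by the ideal of $t$-minors of the matrix $F$) is determinantal of type $(m,n,t)$ if its codimension in $\mathbb{C}^N$ is $(m-t+1)(n-t+1)$. $\mathcal{G}$-versal family: $\tau_{\mathcal G}=\dim_{\mathbb{C}}\operatorname{Mat}(m,n;\mathbb{C}\{\underline{x}\})/(J_F+J_{op})$, where $J_F$ is the submodule generated by the $N$ matrices $\partial F/\partial x_i$ and $J_{op}=\langle AF+FB\mid A\in\operatorname{Mat}(m,m;\mathbb{C}\{\underline{x}\}),\,B\in\operatorname{Mat}(n,n;\mathbb{C}\{\underline{x}\})\rangle$. If $m_1,\dots,m_{\tau}$ is a monomial $\mathbb{C}$-basis of this quotient (each $m_i$ a matrix with exactly one non-zero entry, which is a monomial), the $\mathcal{G}$-versal unfolding is $F_u=F+\sum_{i=1}^{\tau}u_im_i$, and the $\mathcal{G}$-versal family is the family with fibres $X_u=F_u^{-1}(M_{m,n}^t)$ over the base $(\mathbb{C}^{\tau},0)$. Tjurina transform: a matrix $A$ of rank exactly $t-1$ determines the $(n-t+1)$-dimensional subspace $\ker A\subset\mathbb{C}^n$ (equivalently its row space); this is a rational map $P:M_{m,n}^t\dashrightarrow\operatorname{Grass}(n-t+1,n)$. Let $W\subset\mathbb{C}^{mn}\times\operatorname{Grass}(n-t+1,n)$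 be the closure of the graph of $P$ over $M_{m,n}^t\setminus M_{m,n}^{t-1}$, with projection $\rho:W\to M_{m,n}^t$. The Tjurina transform of $X_u$ is the fibre product $Y_u=X_u\times_{M_{m,n}^t}W$ formed via $F_u$ and $\rho$, with projection $\pi_u:Y_u\to X_u$. *)

theory Defs
  imports "HOL-Analysis.Analysis" "HOL-Library.Extended_Nat"
begin

section \<open>Holomorphic germs and ideals\<close>

text \<open>
  Germs at a point \<open>p\<close> of complex affine space are represented by total functions whose values away
  from \<open>p\<close> are irrelevant. The convergent power series ring in the coordinates centred at \<open>p\<close> is
  the ring of germs of holomorphic functions at \<open>p\<close>. All sets of germs below (ideals, submodules)
  are closed under equality near the base point, so equality of such sets of functions is equality
  of the sets of germs.
\<close>

definition complex_differentiable_at :: "(complex^'i \<Rightarrow> complex) \<Rightarrow> complex^'i \<Rightarrow> bool" where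
  "complex_differentiable_at f x \<longleftrightarrow>
     (\<exists>D. (f has_derivative D) (at x) \<and> (\<forall>c v. D (c *s v) = c * D v))"

definition hol_at :: "(complex^'i \<Rightarrow> complex) \<Rightarrow> complex^'i \<Rightarrow> bool" where
  "hol_at f p \<longleftrightarrow> (\<forall>\<^sub>F x in nhds p. complex_differentiable_at f x)"

definition hol_mat_at :: "(complex^'i \<Rightarrow> complex^'n^'m) \<Rightarrow> complex^'i \<Rightarrow> bool" where
  "hol_mat_at G p \<longleftrightarrow> (\<forall>a b. hol_at (\<lambda>x. G x $ a $ b) p)"

definition partial_deriv :: "'i \<Rightarrow> (complex^'i \<Rightarrow> complex) \<Rightarrow> complex^'i \<Rightarrow> complex" where
  "partial_deriv i f x = deriv (\<lambda>s. f (x + s *s axis i 1)) 0"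

definition gradient :: "(complex^'i \<Rightarrow> complex) \<Rightarrow> complex^'i \<Rightarrow> complex^'i" where
  "gradient f x = (\<chi> i. partial_deriv i f x)"

definition independent_differentials ::
    "nat \<Rightarrow> (nat \<Rightarrow> complex^'i \<Rightarrow> complex) \<Rightarrow> complex^'i \<Rightarrow> bool" where
  "independent_differentials c g p \<longleftrightarrow>
     (\<forall>a. (\<Sum>k<c. a k *s gradient (g k) p) = 0 \<longrightarrow> (\<forall>k<c. a k = 0))"

definition germ_ideal ::
    "complex^'i \<Rightarrow> (complex^'i \<Rightarrow> complex) set \<Rightarrow> (complex^'i \<Rightarrow> complex) set" where
  "germ_ideal p G = {f. hol_at f p \<and>
     (\<exists>S h. finite S \<and> S \<subseteq> G \<and> (\<forall>g\<in>S. hol_at (h g) p) \<and>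
            (\<forall>\<^sub>F x in nhds p. f x = (\<Sum>g\<in>S. h g x * g x)))}"

text \<open>
  The complex subspace with ideal \<open>J\<close> (including possible nilpotents) is smooth at \<open>p\<close> if it is a
  complex submanifold there: \<open>J\<close> is generated by part of a system of local coordinates at \<open>p\<close>. In
  particular \<open>p\<close> is then a point of the subspace.
\<close>

definition smooth_at :: "complex^'i \<Rightarrow> (complex^'i \<Rightarrow> complex) set \<Rightarrow> bool" where
  "smooth_at p J \<longleftrightarrow>
     (\<exists>c g. (\<forall>k<c. hol_at (g k) p \<and> g k p = 0) \<and> independent_differentials c g p \<and>
            J = germ_ideal p (g ` {..<c}))"

section \<open>Dimension of an analytic set at a point\<close>

definition regular_point :: "(complex^'i) set \<Rightarrow> nat \<Rightarrow> complex^'i \<Rightarrow> bool" where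
  "regular_point X d z \<longleftrightarrow> z \<in> X \<and>
     (\<exists>c g. d + c = CARD('i) \<and> (\<forall>k<c. hol_at (g k) z) \<and> independent_differentials c g z \<and>
            (\<forall>\<^sub>F w in nhds z. w \<in> X \<longleftrightarrow> (\<forall>k<c. g k w = 0)))"

text \<open>
  The dimension of \<open>X\<close> at \<open>p\<close> is the largest dimension of the manifold of regular points in
  arbitrarily small neighbourhoods of \<open>p\<close>. It depends only on the germ of \<open>X\<close> at \<open>p\<close>, and is used
  only if \<open>X\<close> is analytic near \<open>p\<close> and contains \<open>p\<close>; then the maximum is over a nonempty set.
\<close>

definition analytic_dim :: "(complex^'i) set \<Rightarrow> complex^'i \<Rightarrow> nat" where
  "analytic_dim X p = Max {d. p \<in> closure {z. regular_point X d z}}"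

section \<open>Determinantal singularities\<close>

definition mat_lt :: "nat \<Rightarrow> (complex^'n^'m) set" where
  "mat_lt t = {A. rank A < t}"

definition minor :: "nat \<Rightarrow> (nat \<Rightarrow> 'm) \<Rightarrow> (nat \<Rightarrow> 'n) \<Rightarrow> complex^'n^'m \<Rightarrow> complex" where
  "minor t r s A = (\<Sum>p | p permutes {..<t}. of_int (sign p) * (\<Prod>i<t. A $ r i $ s (p i)))"

definition pullback_minors ::
    "nat \<Rightarrow> (complex^'N \<Rightarrow> complex^'n^'m) \<Rightarrow> (complex^'N \<Rightarrow> complex) set" where
  "pullback_minors t F =
     {\<lambda>x. minor t r s (F x) | r s. inj_on r {..<t} \<and> inj_on s {..<t}}"

definition determinantal_singularity ::
    "nat \<Rightarrow> (complex^'N \<Rightarrow> complex^'n^'m) \<Rightarrow> bool" where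
  "determinantal_singularity t F \<longleftrightarrow>
     hol_mat_at F 0 \<and> 0 \<in> F -` mat_lt t \<and>
     analytic_dim (F -` mat_lt t) 0 + (CARD('m) - t + 1) * (CARD('n) - t + 1) = CARD('N)"

section \<open>The versal unfolding\<close>

definition J_F ::
    "(complex^'N \<Rightarrow> complex^'n^'m) \<Rightarrow> (complex^'N \<Rightarrow> complex^'n^'m) set" where
  "J_F F = {G. hol_mat_at G 0 \<and>
     (\<exists>c. (\<forall>k. hol_at (c k) 0) \<and>
          (\<forall>\<^sub>F x in nhds 0. \<forall>a b.
             G x $ a $ b = (\<Sum>k\<in>UNIV. c k x * partial_deriv k (\<lambda>x. F x $ a $ b) x)))}"

definition J_op ::
    "(complex^'N \<Rightarrow> complex^'n^'m) \<Rightarrow> (complex^'N \<Rightarrow> complex^'n^'m) set" where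
  "J_op F = {G. hol_mat_at G 0 \<and>
     (\<exists>(A :: complex^'N \<Rightarrow> complex^'m^'m) (B :: complex^'N \<Rightarrow> complex^'n^'n).
          hol_mat_at A 0 \<and> hol_mat_at B 0 \<and>
          (\<forall>\<^sub>F x in nhds 0. G x = A x ** F x + F x ** B x))}"

definition G_tangent ::
    "(complex^'N \<Rightarrow> complex^'n^'m) \<Rightarrow> (complex^'N \<Rightarrow> complex^'n^'m) set" where
  "G_tangent F = {\<lambda>x. G x + H x | G H. G \<in> J_F F \<and> H \<in> J_op F}"

definition lin_comb ::
    "nat \<Rightarrow> (nat \<Rightarrow> complex) \<Rightarrow> (nat \<Rightarrow> complex^'N \<Rightarrow> complex^'n^'m) \<Rightarrow>
     complex^'N \<Rightarrow> complex^'n^'m" where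
  "lin_comb d c g x = (\<chi> a b. \<Sum>i<d. c i * g i x $ a $ b)"

text \<open>Linear independence and generation over the complex numbers in \<open>Mat(m,n;\<complex>{x}) / T\<close>.\<close>

definition independent_mod ::
    "(complex^'N \<Rightarrow> complex^'n^'m) set \<Rightarrow> nat \<Rightarrow> (nat \<Rightarrow> complex^'N \<Rightarrow> complex^'n^'m) \<Rightarrow> bool" where
  "independent_mod T d g \<longleftrightarrow> (\<forall>i<d. hol_mat_at (g i) 0) \<and>
     (\<forall>c. lin_comb d c g \<in> T \<longrightarrow> (\<forall>i<d. c i = 0))"

definition spanning_mod ::
    "(complex^'N \<Rightarrow> complex^'n^'m) set \<Rightarrow> nat \<Rightarrow> (nat \<Rightarrow> complex^'N \<Rightarrow> complex^'n^'m) \<Rightarrow> bool" where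
  "spanning_mod T d g \<longleftrightarrow> (\<forall>i<d. hol_mat_at (g i) 0) \<and>
     (\<forall>G. hol_mat_at G 0 \<longrightarrow> (\<exists>c. (\<lambda>x. G x - lin_comb d c g x) \<in> T))"

definition tjurina_number :: "(complex^'N \<Rightarrow> complex^'n^'m) \<Rightarrow> enat" where
  "tjurina_number F = (SUP d\<in>{d. \<exists>g. independent_mod (G_tangent F) d g}. enat d)"

text \<open>\<open>(a, b, \<alpha>)\<close> encodes the matrix with the single non-zero entry \<open>x^\<alpha>\<close> at position \<open>(a, b)\<close>.\<close>

definition monomial_matrix ::
    "'m \<times> 'n \<times> ('N \<Rightarrow> nat) \<Rightarrow> complex^'N \<Rightarrow> complex^'n^'m" where
  "monomial_matrix = (\<lambda>(a, b, \<alpha>) x. \<chi> i j. if i = a \<and> j = b then \<Prod>k\<in>UNIV. x $ k ^ \<alpha> k else 0)"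

definition monomial_basis ::
    "(complex^'N \<Rightarrow> complex^'n^'m) \<Rightarrow> nat \<Rightarrow> (nat \<Rightarrow> 'm \<times> 'n \<times> ('N \<Rightarrow> nat)) \<Rightarrow> bool" where
  "monomial_basis F \<tau> ms \<longleftrightarrow>
     independent_mod (G_tangent F) \<tau> (\<lambda>i. monomial_matrix (ms i)) \<and>
     spanning_mod (G_tangent F) \<tau> (\<lambda>i. monomial_matrix (ms i))"

definition unfolding_of ::
    "(complex^'N \<Rightarrow> complex^'n^'m) \<Rightarrow> nat \<Rightarrow> (nat \<Rightarrow> 'm \<times> 'n \<times> ('N \<Rightarrow> nat)) \<Rightarrow>
     (nat \<Rightarrow> complex) \<Rightarrow> complex^'N \<Rightarrow> complex^'n^'m" where
  "unfolding_of F \<tau> ms u x = F x + lin_comb \<tau> u (\<lambda>i. monomial_matrix (ms i)) x"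

text \<open>
  The space \<open>\<complex>^\<tau>\<close> is modelled by the sequences vanishing from index \<open>\<tau>\<close> on, since \<open>\<tau>\<close> is determined
  by \<open>F\<close> and may be 0.
\<close>

definition base_ball :: "nat \<Rightarrow> real \<Rightarrow> (nat \<Rightarrow> complex) set" where
  "base_ball \<tau> \<delta> = {u. (\<forall>i\<ge>\<tau>. u i = 0) \<and> L2_set (\<lambda>i. cmod (u i)) {..<\<tau>} < \<delta>}"

text \<open>In the following, \<open>G\<close> plays the role of \<open>F_u\<close>, and \<open>\<epsilon>\<close> is the radius of the representative.\<close>

definition fibre :: "nat \<Rightarrow> real \<Rightarrow> (complex^'N \<Rightarrow> complex^'n^'m) \<Rightarrow> (complex^'N) set" where
  "fibre t \<epsilon> G = {x \<in> ball 0 \<epsilon>. G x \<in> mat_lt t}"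

definition fibre_singular_at ::
    "nat \<Rightarrow> (complex^'N \<Rightarrow> complex^'n^'m) \<Rightarrow> complex^'N \<Rightarrow> bool" where
  "fibre_singular_at t G x \<longleftrightarrow> \<not> smooth_at x (germ_ideal x (pullback_minors t G))"

section \<open>Grassmannian and Tjurina transform\<close>

text \<open>
  The affine chart of the Grassmannian belonging to a \<open>k\<close>-element set \<open>I\<close> of coordinates consists of
  the subspaces \<open>v_j = \<Sum>i\<in>I. Z_{ji} v_i\<close> (\<open>j \<notin> I\<close>), that is, of the graphs of the linear maps \<open>Z\<close> from
  the coordinate space of \<open>I\<close> to that of its complement. The space of these \<open>Z\<close> is embedded
  as a linear subspace in all \<open>n \<times> n\<close> matrices.
\<close>

definition chart_space :: "'n set \<Rightarrow> (complex^'n^'n) set" where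
  "chart_space I = {Z. \<forall>j i. j \<in> I \<or> i \<notin> I \<longrightarrow> Z $ j $ i = 0}"

definition grass_chart :: "'n set \<Rightarrow> complex^'n^'n \<Rightarrow> (complex^'n) set" where
  "grass_chart I Z = {v. \<forall>j. j \<notin> I \<longrightarrow> v $ j = (\<Sum>i\<in>I. Z $ j $ i * v $ i)}"

text \<open>
  The manifold topology on the set of \<open>k\<close>-dimensional subspaces; its underlying set is covered by
  the charts.
\<close>

definition grass_topology :: "nat \<Rightarrow> (complex^'n) set topology" where
  "grass_topology k =
     topology_generated_by {grass_chart I ` (U \<inter> chart_space I) | I U. card I = k \<and> open U}"

definition mat_kernel :: "complex^'n^'m \<Rightarrow> (complex^'n) set" where
  "mat_kernel A = {v. A *v v = 0}"

definition tjurina_W :: "nat \<Rightarrow> ((complex^'n^'m) \<times> (complex^'n) set) set" where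
  "tjurina_W t =
     (prod_topology euclidean (grass_topology (CARD('n) - t + 1))) closure_of
       {(A, mat_kernel A) | A. A \<in> mat_lt t - mat_lt (t - 1)}"

text \<open>The points \<open>(x, (A, V))\<close> of the fibre product; \<open>fst\<close> is the projection to \<open>X_u\<close>.\<close>

definition tjurina_transform ::
    "nat \<Rightarrow> real \<Rightarrow> (complex^'N \<Rightarrow> complex^'n^'m) \<Rightarrow>
     ((complex^'N) \<times> (complex^'n^'m) \<times> (complex^'n) set) set" where
  "tjurina_transform t \<epsilon> G = {(x, w). x \<in> fibre t \<epsilon> G \<and> w \<in> tjurina_W t \<and> G x = fst w}"

definition join_vec :: "complex^'i \<Rightarrow> complex^'j \<Rightarrow> complex^('i + 'j)" where
  "join_vec a b = (\<chi> s. case s of Inl i \<Rightarrow> a $ i | Inr j \<Rightarrow> b $ j)"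

definition left_part :: "complex^('i::finite + 'j::finite) \<Rightarrow> complex^'i" where
  "left_part z = (\<chi> i. z $ Inl i)"

definition right_part :: "complex^('i::finite + 'j::finite) \<Rightarrow> complex^'j" where
  "right_part z = (\<chi> j. z $ Inr j)"

definition flatten_mat :: "complex^'n^'m \<Rightarrow> complex^('m \<times> 'n)" where
  "flatten_mat A = (\<chi> q. A $ fst q $ snd q)"

definition unflatten_mat :: "complex^('m::finite \<times> 'n::finite) \<Rightarrow> complex^'n^'m" where
  "unflatten_mat w = (\<chi> a b. w $ (a, b))"

text \<open>
  \<open>W\<close> in the chart \<open>I\<close>, with coordinates \<open>(A, Z)\<close>, as a subset of the vector space of all pairs of an
  \<open>m \<times> n\<close> and an \<open>n \<times> n\<close> matrix.
\<close>

definition W_in_chart :: "nat \<Rightarrow> 'n::finite set \<Rightarrow> (complex^('m::finite \<times> 'n + 'n \<times> 'n)) set" where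
  "W_in_chart t I = {w. unflatten_mat (right_part w) \<in> chart_space I \<and>
     (unflatten_mat (left_part w) :: complex^'n^'m,
      grass_chart I (unflatten_mat (right_part w))) \<in> tjurina_W t}"

text \<open>
  \<open>W\<close> carries the reduced structure: it is the closure of a graph over a manifold. The vanishing
  ideal contains the equations of the linear subspace \<open>chart_space I\<close>.
\<close>

definition W_ideal ::
    "nat \<Rightarrow> 'n::finite set \<Rightarrow> complex^('m::finite \<times> 'n + 'n \<times> 'n) \<Rightarrow>
     (complex^('m \<times> 'n + 'n \<times> 'n) \<Rightarrow> complex) set" where
  "W_ideal t I p = {f. hol_at f p \<and> (\<forall>\<^sub>F w in nhds p. w \<in> W_in_chart t I \<longrightarrow> f w = 0)}"

text \<open>
  Generators, at \<open>p\<close>, of the ideal of the fibre product as a subspace of \<open>X_u \<times> W\<close>, in the chart \<open>I\<close>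
  with coordinates \<open>(x, A, Z)\<close>: the equations of \<open>X_u\<close>, those of \<open>W\<close>, and \<open>A = F_u(x)\<close>.
\<close>

definition transform_generators ::
    "nat \<Rightarrow> (complex^'N \<Rightarrow> complex^'n^'m) \<Rightarrow> 'n set \<Rightarrow>
     complex^('N + ('m \<times> 'n + 'n \<times> 'n)) \<Rightarrow>
     (complex^('N + ('m \<times> 'n + 'n \<times> 'n)) \<Rightarrow> complex) set" where
  "transform_generators t G I p =
     {\<lambda>y. f (left_part y) | f. f \<in> pullback_minors t G} \<union>
     {\<lambda>y. f (right_part y) | f. f \<in> W_ideal t I (right_part p)} \<union>
     {\<lambda>y. unflatten_mat (left_part (right_part y)) $ a $ b - G (left_part y) $ a $ b | a b. True}"

definition transform_smooth_at ::
    "nat \<Rightarrow> (complex^'N \<Rightarrow> complex^'n^'m) \<Rightarrow> (complex^'N) \<times> (complex^'n^'m) \<times> (complex^'n) set \<Rightarrow> bool"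
  where
  "transform_smooth_at t G = (\<lambda>(x, A, V).
     \<exists>I Z. card I = CARD('n) - t + 1 \<and> Z \<in> chart_space I \<and> V = grass_chart I Z \<and>
       (let p = join_vec x (join_vec (flatten_mat A) (flatten_mat Z))
        in smooth_at p (germ_ideal p (transform_generators t G I p))))"

section \<open>Discriminants\<close>

text \<open>
  Discriminants of the representative of the versal family with fibres in the ball of radius \<open>\<epsilon>\<close>
  and base the ball of radius \<open>\<delta>\<close>.
\<close>

definition discriminant ::
    "nat \<Rightarrow> (complex^'N \<Rightarrow> complex^'n^'m) \<Rightarrow> nat \<Rightarrow> (nat \<Rightarrow> 'm \<times> 'n \<times> ('N \<Rightarrow> nat)) \<Rightarrow>
     real \<Rightarrow> real \<Rightarrow> (nat \<Rightarrow> complex) set" where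
  "discriminant t F \<tau> ms \<epsilon> \<delta> =
     {u \<in> base_ball \<tau> \<delta>.
        \<exists>x \<in> fibre t \<epsilon> (unfolding_of F \<tau> ms u). fibre_singular_at t (unfolding_of F \<tau> ms u) x}"

definition discriminant_A ::
    "nat \<Rightarrow> (complex^'N \<Rightarrow> complex^'n^'m) \<Rightarrow> nat \<Rightarrow> (nat \<Rightarrow> 'm \<times> 'n \<times> ('N \<Rightarrow> nat)) \<Rightarrow>
     real \<Rightarrow> real \<Rightarrow> (nat \<Rightarrow> complex) set" where
  "discriminant_A t F \<tau> ms \<epsilon> \<delta> =
     {u \<in> base_ball \<tau> \<delta>.
        \<exists>x \<in> fibre t \<epsilon> (unfolding_of F \<tau> ms u). rank (unfolding_of F \<tau> ms u x) < t - 1}"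

definition discriminant_B ::
    "nat \<Rightarrow> (complex^'N \<Rightarrow> complex^'n^'m) \<Rightarrow> nat \<Rightarrow> (nat \<Rightarrow> 'm \<times> 'n \<times> ('N \<Rightarrow> nat)) \<Rightarrow>
     real \<Rightarrow> real \<Rightarrow> (nat \<Rightarrow> complex) set" where
  "discriminant_B t F \<tau> ms \<epsilon> \<delta> =
     {u \<in> base_ball \<tau> \<delta>.
        \<exists>x \<in> fibre t \<epsilon> (unfolding_of F \<tau> ms u). fibre_singular_at t (unfolding_of F \<tau> ms u) x \<and>
          (\<exists>y \<in> tjurina_transform t \<epsilon> (unfolding_of F \<tau> ms u).
             fst y = x \<and> \<not> transform_smooth_at t (unfolding_of F \<tau> ms u) y)}"

end

theory Submission
  imports Defs "HOL-Complex_Analysis.Complex_Analysis" "Jordan_Normal_Form.Determinant"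
begin

text \<open>
  Write \<open>G\<close> for a matrix \<open>F_u\<close> of the family. By definition \<open>D_B \<subseteq> D\<close>, so two inclusions have to be
  shown.

  First, \<open>D_A \<subseteq> D\<close>. At a point \<open>x\<close> where \<open>G x\<close> has rank less than \<open>t - 1\<close>, all \<open>t\<close>-minors vanish to second
  order, because a change of a single entry raises the rank by at most one
  (\<open>gradient_minor_eq_0\<close>). A non-zero ideal all of whose elements have gradient zero is not generated
  by functions with independent differentials. Hence \<open>x\<close> is a singular point of the fibre, unless all
  minors of \<open>G\<close> vanish identically near \<open>x\<close>. This exception does not occur: since \<open>X\<close> has positive
  codimension, some minor of \<open>F\<close> is non-zero at some point \<open>y\<close> of the ball
  (\<open>exists_nonzero_minor_near_0\<close>), it remains non-zero at \<open>y\<close> for small \<open>u\<close>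
  (\<open>minor_nonzero_small_unfolding\<close>), and by the identity theorem it then vanishes on no open part of the
  ball (\<open>identity_theorem_ball\<close>).

  Second, \<open>D \<subseteq> D_A \<union> D_B\<close>. Let \<open>x\<close> be a point where \<open>G x\<close> has rank exactly \<open>t - 1\<close>. Near \<open>x\<close> the Tjurina
  transform is isomorphic to the fibre, so that \<open>x\<close> is a smooth point if the point \<open>(x, G x, ker (G x))\<close>
  above it is smooth (\<open>smooth_if_transform_smooth\<close>). The scheme structures make this
  a statement about ideals. In the coordinates of a chart of the Grassmannian the transform lies in a
  product of three vector spaces; the fibre is embedded there by \<open>y \<mapsto> (y, G y, \<zeta> (G y))\<close>, where \<open>\<zeta>\<close> is a
  holomorphic extension of the map \<open>A \<mapsto> ker A\<close> from matrices of rank \<open>t - 1\<close> to their neighbourhood. The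
  embedding has a linear left inverse, the projection, and smoothness descends along such an embedding
  as soon as the ideals pull back into each other (\<open>smooth_at_retract\<close>, by Nakayama's lemma).

  The ideal of \<open>W\<close> is a vanishing ideal, whereas the ideal of the fibre is generated by minors. They
  are compared with the help of an explicit holomorphic retraction onto the
  matrices of rank \<open>t - 1\<close>: near a matrix with a non-zero minor of size \<open>t - 1\<close>, the difference of a
  matrix and its retract consists of bordered minors divided by the given minor (\<open>bordered_eq\<close>), and
  Hadamard's lemma (\<open>hadamard_lemma\<close>) then writes every function that vanishes on \<open>W\<close>, after
  substitution, as a combination of the bordered minors.
\<close>

section \<open>Holomorphic functions of several variables\<close>

(* The symbol $ is kept for vectors and matrices indexed by finite types only. *)
no_notation fps_nth (infixl \<open>$\<close> 75)
no_notation vec_index (infixl \<open>$\<close> 100)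
hide_const (open) Matrix.mat Matrix.row Matrix.rows Matrix.col Matrix.cols Determinant.det Matrix.vec
  Matrix.transpose_mat
hide_type (open) Matrix.vec Matrix.mat

lemma complex_differentiable_at_cong:
  assumes "complex_differentiable_at f x" "\<forall>\<^sub>F y in nhds x. f y = g y"
  shows "complex_differentiable_at g x"
proof -
  obtain D where D: "(f has_derivative D) (at x)" "\<forall>c v. D (c *s v) = c * D v"
    using assms unfolding complex_differentiable_at_def by blast
  have "(g has_derivative D) (at x)"
    using has_derivative_transform_eventually[OF D(1)] assms(2)
    by (simp add: eventually_nhds_conv_at)
  with D(2) show ?thesis unfolding complex_differentiable_at_def by blast
qed

lemma hol_at_cong:
  assumes "hol_at f p" "\<forall>\<^sub>F y in nhds p. f y = g y"
  shows "hol_at g p"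
proof -
  have "\<forall>\<^sub>F x in nhds p. \<forall>\<^sub>F y in nhds x. f y = g y"
    using assms(2) by (simp add: eventually_eventually)
  with assms(1) show ?thesis unfolding hol_at_def
    by eventually_elim (rule complex_differentiable_at_cong)
qed

lemma hol_at_imp_complex_differentiable_at: "hol_at f p \<Longrightarrow> complex_differentiable_at f p"
  unfolding hol_at_def by (rule eventually_nhds_x_imp_x)

lemma complex_differentiable_at_imp_isCont: "complex_differentiable_at f x \<Longrightarrow> isCont f x"
  unfolding complex_differentiable_at_def by (blast intro: has_derivative_continuous)

lemma complex_differentiable_at_const [simp]: "complex_differentiable_at (\<lambda>_. c) x"
  unfolding complex_differentiable_at_def by (rule exI[of _ "\<lambda>_. 0"]) auto

lemma complex_differentiable_at_coord [simp]: "complex_differentiable_at (\<lambda>x. x $ i) x"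
  unfolding complex_differentiable_at_def
  by (rule exI[of _ "\<lambda>v. v $ i"]) (auto intro: bounded_linear_imp_has_derivative bounded_linear_vec_nth)

lemma complex_differentiable_at_add:
  "complex_differentiable_at f x \<Longrightarrow> complex_differentiable_at g x \<Longrightarrow>
   complex_differentiable_at (\<lambda>x. f x + g x) x"
  unfolding complex_differentiable_at_def
  by (metis (mono_tags, lifting) has_derivative_add distrib_left)

lemma complex_differentiable_at_diff:
  "complex_differentiable_at f x \<Longrightarrow> complex_differentiable_at g x \<Longrightarrow>
   complex_differentiable_at (\<lambda>x. f x - g x) x"
  unfolding complex_differentiable_at_def
  by (metis (mono_tags, lifting) has_derivative_diff right_diff_distrib)

lemma complex_differentiable_at_mult:
  assumes "complex_differentiable_at f x" "complex_differentiable_at g x"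
  shows "complex_differentiable_at (\<lambda>x. f x * g x) x"
proof -
  obtain D E where D: "(f has_derivative D) (at x)" "\<forall>c v. D (c *s v) = c * D v"
    and E: "(g has_derivative E) (at x)" "\<forall>c v. E (c *s v) = c * E v"
    using assms unfolding complex_differentiable_at_def by blast
  show ?thesis unfolding complex_differentiable_at_def
    by (rule exI[of _ "\<lambda>v. f x * E v + D v * g x"])
       (use has_derivative_mult[OF D(1) E(1)] D(2) E(2) in \<open>auto simp: algebra_simps\<close>)
qed

lemma complex_differentiable_at_compose_field:
  assumes "complex_differentiable_at f x" "(\<phi> has_field_derivative \<phi>') (at (f x))"
  shows "complex_differentiable_at (\<lambda>x. \<phi> (f x)) x"
proof -
  obtain D where D: "(f has_derivative D) (at x)" "\<forall>c v. D (c *s v) = c * D v"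
    using assms unfolding complex_differentiable_at_def by blast
  have "((\<lambda>x. \<phi> (f x)) has_derivative (\<lambda>v. \<phi>' * D v)) (at x)"
    using has_derivative_compose[OF D(1) assms(2)[unfolded has_field_derivative_def]] by simp
  then show ?thesis unfolding complex_differentiable_at_def
    by (intro exI[of _ "\<lambda>v. \<phi>' * D v"]) (auto simp: D(2))
qed

lemma has_derivative_vec_lambda:
  fixes f :: "'j::finite \<Rightarrow> 'a::real_normed_vector \<Rightarrow> 'b::euclidean_space"
  assumes "\<And>j. (f j has_derivative D j) (at x within S)"
  shows "((\<lambda>x. \<chi> j. f j x) has_derivative (\<lambda>v. \<chi> j. D j v)) (at x within S)"
  unfolding has_derivative_componentwise_within[of "\<lambda>x. \<chi> j. f j x"]
  using has_derivative_inner_left[OF assms]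
  by (auto simp: Basis_vec_def inner_axis)

lemma complex_differentiable_at_compose:
  fixes g :: "complex^'i \<Rightarrow> complex^'j"
  assumes f: "complex_differentiable_at f (g x)"
    and g: "\<And>j. complex_differentiable_at (\<lambda>x. g x $ j) x"
  shows "complex_differentiable_at (\<lambda>x. f (g x)) x"
proof -
  obtain D where D: "(f has_derivative D) (at (g x))" "\<forall>c v. D (c *s v) = c * D v"
    using f unfolding complex_differentiable_at_def by blast
  have "\<forall>j. \<exists>D. ((\<lambda>x. g x $ j) has_derivative D) (at x) \<and> (\<forall>c v. D (c *s v) = c * D v)"
    using g unfolding complex_differentiable_at_def by blast
  then obtain E where E: "\<And>j. ((\<lambda>x. g x $ j) has_derivative E j) (at x)"
      "\<And>j c v. E j (c *s v) = c * E j v" by metis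
  have "(g has_derivative (\<lambda>v. \<chi> j. E j v)) (at x)"
    using has_derivative_vec_lambda[of "\<lambda>j x. g x $ j" E x UNIV] E(1) by simp
  from has_derivative_compose[OF this D(1)]
  have "((\<lambda>x. f (g x)) has_derivative (\<lambda>v. D (\<chi> j. E j v))) (at x)" .
  moreover have "(\<chi> j. E j (c *s v)) = c *s (\<chi> j. E j v)" for c v
    by (simp add: Finite_Cartesian_Product.vec_eq_iff E(2))
  ultimately show ?thesis unfolding complex_differentiable_at_def
    by (intro exI[of _ "\<lambda>v. D (\<chi> j. E j v)"]) (simp add: D(2))
qed

lemma hol_at_const [simp, intro]: "hol_at (\<lambda>_. c) p"
  by (simp add: hol_at_def)

lemma hol_at_coord [simp, intro]: "hol_at (\<lambda>x. x $ i) p"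
  by (simp add: hol_at_def)

lemma hol_at_add [intro]:
  assumes "hol_at f p" "hol_at g p" shows "hol_at (\<lambda>x. f x + g x) p"
  using assms unfolding hol_at_def by eventually_elim (rule complex_differentiable_at_add)

lemma hol_at_diff [intro]:
  assumes "hol_at f p" "hol_at g p" shows "hol_at (\<lambda>x. f x - g x) p"
  using assms unfolding hol_at_def by eventually_elim (rule complex_differentiable_at_diff)

lemma hol_at_mult [intro]:
  assumes "hol_at f p" "hol_at g p" shows "hol_at (\<lambda>x. f x * g x) p"
  using assms unfolding hol_at_def by eventually_elim (rule complex_differentiable_at_mult)

lemma hol_at_uminus [intro]: "hol_at f p \<Longrightarrow> hol_at (\<lambda>x. - f x) p"
  using hol_at_diff[OF hol_at_const[of 0]] by simp

lemma hol_at_sum [intro]: "(\<And>i. i \<in> S \<Longrightarrow> hol_at (f i) p) \<Longrightarrow> hol_at (\<lambda>x. \<Sum>i\<in>S. f i x) p"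
  by (induction S rule: infinite_finite_induct) auto

lemma hol_at_prod [intro]: "(\<And>i. i \<in> S \<Longrightarrow> hol_at (f i) p) \<Longrightarrow> hol_at (\<lambda>x. \<Prod>i\<in>S. f i x) p"
  by (induction S rule: infinite_finite_induct) auto

lemma hol_at_power [intro]: "hol_at f p \<Longrightarrow> hol_at (\<lambda>x. f x ^ k) p"
  by (induction k) auto

lemma hol_at_imp_isCont: "hol_at f p \<Longrightarrow> isCont f p"
  by (simp add: complex_differentiable_at_imp_isCont hol_at_imp_complex_differentiable_at)

lemma hol_at_imp_eventually_nonzero:
  assumes "hol_at f p" "f p \<noteq> 0" shows "\<forall>\<^sub>F x in nhds p. f x \<noteq> 0"
proof -
  have "f \<midarrow>p\<rightarrow> f p" using hol_at_imp_isCont[OF assms(1)] by (simp add: isCont_def)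
  then have "\<forall>\<^sub>F x in at p. f x \<noteq> 0"
    using assms(2) by (rule tendsto_imp_eventually_ne)
  then show ?thesis using assms(2) by (simp add: eventually_nhds_conv_at)
qed

lemma hol_at_divide [intro]:
  assumes "hol_at f p" "hol_at g p" "g p \<noteq> 0" shows "hol_at (\<lambda>x. f x / g x) p"
proof -
  have "hol_at (\<lambda>x. inverse (g x)) p"
    using assms(2) hol_at_imp_eventually_nonzero[OF assms(2,3)] unfolding hol_at_def
    by eventually_elim
       (rule complex_differentiable_at_compose_field[OF _ DERIV_inverse])
  from hol_at_mult[OF assms(1) this] show ?thesis by (simp add: divide_inverse)
qed

lemma isCont_vec:
  fixes g :: "complex^'i \<Rightarrow> complex^'j"
  assumes "\<And>j. hol_at (\<lambda>x. g x $ j) p" shows "isCont g p"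
  using assms hol_at_imp_isCont unfolding isCont_def by (blast intro: vec_tendstoI)

lemma eventually_compose_nhds:
  assumes "isCont g p" "\<forall>\<^sub>F y in nhds (g p). P y" shows "\<forall>\<^sub>F x in nhds p. P (g x)"
proof -
  have "filterlim g (nhds (g p)) (nhds p)"
    using assms(1) by (simp add: isCont_def tendsto_at_iff_tendsto_nhds)
  with assms(2) show ?thesis by (auto simp: filterlim_iff)
qed

lemma hol_at_compose:
  fixes g :: "complex^'i \<Rightarrow> complex^'j"
  assumes f: "hol_at f (g p)" and g: "\<And>j. hol_at (\<lambda>x. g x $ j) p"
  shows "hol_at (\<lambda>x. f (g x)) p"
proof -
  have "\<forall>\<^sub>F x in nhds p. complex_differentiable_at f (g x)"
    using eventually_compose_nhds[OF isCont_vec[OF g]] f unfolding hol_at_def by blast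
  moreover have "\<forall>\<^sub>F x in nhds p. \<forall>j. complex_differentiable_at (\<lambda>x. g x $ j) x"
    using g unfolding hol_at_def by (simp add: eventually_all_finite)
  ultimately show ?thesis unfolding hol_at_def
    by eventually_elim (rule complex_differentiable_at_compose, auto)
qed

text \<open>
  The derivative of a holomorphic function is a real linear map that commutes with complex scalars.
  It is therefore determined by its values on the complex standard basis, which are the partial
  derivatives.
\<close>

lemma complex_linear_expansion:
  fixes D :: "complex^'i \<Rightarrow> complex"
  assumes "linear D" "\<And>c v. D (c *s v) = c * D v"
  shows "D v = (\<Sum>i\<in>UNIV. v $ i * D (axis i 1))"
proof -
  have "D v = D (\<Sum>i\<in>UNIV. v $ i *s axis i 1)" by (simp add: basis_expansion)
  also have "\<dots> = (\<Sum>i\<in>UNIV. D (v $ i *s axis i 1))" by (rule linear_sum[OF assms(1)])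
  finally show ?thesis by (simp add: assms(2))
qed

lemma complex_line_has_derivative:
  fixes v :: "complex^'i"
  shows "((\<lambda>s. x + s *s v) has_derivative (\<lambda>s. s *s v)) (at s0)"
proof -
  have "((\<lambda>s. \<chi> i. (x + s *s v) $ i) has_derivative (\<lambda>s. \<chi> i. (s *s v) $ i)) (at s0)"
    by (rule has_derivative_vec_lambda) (auto intro!: derivative_eq_intros)
  then show ?thesis by (simp only: vec_nth_inverse)
qed

lemma has_field_derivative_on_complex_line:
  fixes x v :: "complex^'i"
  assumes "(f has_derivative D) (at (x + s *s v))" "\<And>c v. D (c *s v) = c * D v"
  shows "((\<lambda>s. f (x + s *s v)) has_field_derivative D v) (at s)"
  using has_derivative_compose[OF complex_line_has_derivative[of x v s] assms(1)]
  by (simp add: has_field_derivative_def assms(2) mult.commute[of _ "D v"] mult_commute_abs)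

lemma partial_deriv_eqI:
  assumes "(f has_derivative D) (at x)" "\<And>c v. D (c *s v) = c * D v"
  shows "partial_deriv i f x = D (axis i 1)"
  unfolding partial_deriv_def
  by (rule DERIV_imp_deriv) (rule has_field_derivative_on_complex_line, use assms in auto)

lemma complex_differentiable_at_has_derivative:
  assumes "complex_differentiable_at f x"
  shows "(f has_derivative (\<lambda>v. \<Sum>i\<in>UNIV. v $ i * partial_deriv i f x)) (at x)"
proof -
  obtain D where D: "(f has_derivative D) (at x)" "\<And>c v. D (c *s v) = c * D v"
    using assms unfolding complex_differentiable_at_def by blast
  have "D = (\<lambda>v. \<Sum>i\<in>UNIV. v $ i * partial_deriv i f x)"
    unfolding partial_deriv_eqI[OF D]
    by (rule ext) (rule complex_linear_expansion[OF has_derivative_linear[OF D(1)] D(2)])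
  with D(1) show ?thesis by simp
qed

lemma holomorphic_on_complex_line:
  assumes "\<And>s. s \<in> S \<Longrightarrow> complex_differentiable_at f (x + s *s v)"
  shows "(\<lambda>s. f (x + s *s v)) holomorphic_on S"
  unfolding holomorphic_on_def
proof
  fix s assume "s \<in> S"
  then obtain D where "(f has_derivative D) (at (x + s *s v))" "\<And>c v. D (c *s v) = c * D v"
    using assms unfolding complex_differentiable_at_def by blast
  then show "(\<lambda>s. f (x + s *s v)) field_differentiable at s within S"
    using has_field_derivative_on_complex_line field_differentiable_def field_differentiable_at_within
    by blast
qed

text \<open>
  Cauchy's formula on a circle in the direction of a coordinate axis. The circle can be kept fixed
  while the centre moves, so the right-hand side shows how the partial derivative depends on the
  point and on parameters; this gives continuity and holomorphy of partial derivatives below.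
\<close>

lemma partial_deriv_eq_integral:
  assumes r: "0 < r" and f: "\<And>s. norm s \<le> r \<Longrightarrow> complex_differentiable_at f (x + s *s axis i 1)"
  shows "partial_deriv i f x =
    integral {0..1} (\<lambda>\<theta>. f (x + circlepath 0 r \<theta> *s axis i 1) / circlepath 0 r \<theta>)"
proof -
  let ?g = "\<lambda>s. f (x + s *s axis i 1)"
  have h: "?g holomorphic_on cball 0 r"
    by (rule holomorphic_on_complex_line) (use f in auto)
  have "((\<lambda>u. ?g u / (u - 0) ^ Suc 1) has_contour_integral (2 * pi * \<i>) / fact 1 * (deriv ^^ 1) ?g 0)
      (circlepath 0 r)"
    by (rule Cauchy_has_contour_integral_higher_derivative_circlepath)
       (use h r in \<open>auto intro: holomorphic_on_imp_continuous_on holomorphic_on_subset\<close>)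
  then have "((\<lambda>u. ?g u / u\<^sup>2) has_contour_integral 2 * pi * \<i> * partial_deriv i f x) (circlepath 0 r)"
    by (simp add: partial_deriv_def power2_eq_square)
  then have "2 * pi * \<i> * partial_deriv i f x =
      integral {0..1} (\<lambda>\<theta>. ?g (circlepath 0 r \<theta>) / (circlepath 0 r \<theta>)\<^sup>2 *
        vector_derivative (circlepath 0 r) (at \<theta>))"
    using contour_integral_unique unfolding contour_integral_integral by fastforce
  also have "\<dots> = integral {0..1} (\<lambda>\<theta>. 2 * pi * \<i> * (?g (circlepath 0 r \<theta>) / circlepath 0 r \<theta>))"
    using r by (intro integral_cong) (simp only: vector_derivative_circlepath, simp add: circlepath field_simps power2_eq_square)
  also have "\<dots> = 2 * pi * \<i> * integral {0..1} (\<lambda>\<theta>. ?g (circlepath 0 r \<theta>) / circlepath 0 r \<theta>)"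
    by (rule integral_mult_right)
  finally show ?thesis by simp
qed

text \<open>
  A ball meets the complex line through two of its points in a convex open subset of that line, so
  the identity theorem in one variable suffices.
\<close>

lemma identity_theorem_ball:
  fixes x y :: "complex^'i"
  assumes f: "\<And>y. y \<in> ball 0 \<epsilon> \<Longrightarrow> complex_differentiable_at f y"
    and x: "x \<in> ball 0 \<epsilon>" and z: "\<forall>\<^sub>F y in nhds x. f y = 0" and y: "y \<in> ball 0 \<epsilon>"
  shows "f y = 0"
proof -
  define S where "S = {s. x + s *s (y - x) \<in> ball 0 \<epsilon>}"
  let ?l = "\<lambda>s. x + s *s (y - x)"
  have cont: "continuous_on UNIV ?l"
    by (intro continuous_at_imp_continuous_on ballI has_derivative_continuous)
       (rule complex_line_has_derivative)
  have "open S"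
    unfolding S_def using open_vimage[OF open_ball cont, of 0 \<epsilon>] by (simp add: vimage_def)
  have "linear (\<lambda>s. s *s (y - x))"
    by (rule has_derivative_linear[OF complex_line_has_derivative[of x "y - x" 0]])
  then have "convex ((\<lambda>s. s *s (y - x)) -` ((\<lambda>w. - x + w) ` ball 0 \<epsilon>))"
    by (intro convex_linear_vimage convex_translation convex_ball)
  moreover have "S = ((\<lambda>s. s *s (y - x)) -` ((\<lambda>w. - x + w) ` ball 0 \<epsilon>))"
    unfolding S_def
  proof (intro Set.set_eqI iffI)
    fix s assume "s \<in> {s. x + s *s (y - x) \<in> ball 0 \<epsilon>}"
    then show "s \<in> (\<lambda>s. s *s (y - x)) -` (\<lambda>w. - x + w) ` ball 0 \<epsilon>"
      by (simp add: image_iff) (rule bexI[of _ "x + s *s (y - x)"], auto)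
  qed auto
  ultimately have "connected S" by (simp add: convex_connected)
  have hol: "(\<lambda>s. f (?l s)) holomorphic_on S"
    by (rule holomorphic_on_complex_line) (use f in \<open>auto simp: S_def\<close>)
  have "0 \<in> S" "1 \<in> S" using x y by (auto simp: S_def)
  have "isCont ?l 0"
    by (rule has_derivative_continuous[OF complex_line_has_derivative[of x "y - x" 0]])
  from eventually_compose_nhds[OF this, of "\<lambda>y. f y = 0"] z
  have "\<forall>\<^sub>F s in nhds 0. f (?l s) = 0" by simp
  then obtain U where U: "open U" "0 \<in> U" "\<And>s. s \<in> U \<Longrightarrow> f (?l s) = 0"
    unfolding eventually_nhds by blast
  have "0 islimpt (U \<inter> S)"
    using U \<open>open S\<close> \<open>0 \<in> S\<close> by (intro open_imp_islimpt) auto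
  then have "(\<lambda>s. f (?l s)) 1 = 0"
    by (rule analytic_continuation[OF hol \<open>open S\<close> \<open>connected S\<close> Int_lower2 \<open>0 \<in> S\<close> _ _ \<open>1 \<in> S\<close>])
       (use U(3) in simp)
  then show ?thesis by simp
qed

section \<open>Parameter integrals and Hadamard's lemma\<close>

lemma norm_scaled_axis: "norm (s *s (axis i 1 :: complex^'i)) = norm s"
proof -
  have "s *s (axis i 1 :: complex^'i) = axis i s" by (auto simp: Finite_Cartesian_Product.vec_eq_iff axis_def)
  moreover have "norm (axis i s :: complex^'i) = norm s"
    by (simp add: norm_eq_sqrt_inner inner_axis_axis)
  ultimately show ?thesis by simp
qed

lemma add_scaled_axis_in_cball:
  fixes x p :: "complex^'i"
  assumes "x \<in> ball p r" "norm s \<le> r" shows "x + s *s axis i 1 \<in> cball p (2 * r)"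
proof -
  have "norm (s *s (axis i 1 :: complex^'i)) \<le> r" using assms(2) by (simp add: norm_scaled_axis)
  then show ?thesis
    using assms(1) norm_triangle_ineq4[of "p - x" "s *s axis i 1"]
    by (simp add: dist_norm algebra_simps)
qed

lemma continuous_on_scaled_axis [continuous_intros]:
  "continuous_on S g \<Longrightarrow> continuous_on S (\<lambda>x. g x *s (axis i 1 :: complex^'i))"
proof -
  assume g: "continuous_on S g"
  have "(\<lambda>x. g x *s (axis i 1 :: complex^'i)) = (\<lambda>x. \<chi> j. if j = i then g x else 0)"
    by (auto simp: Finite_Cartesian_Product.vec_eq_iff axis_def)
  moreover have "continuous_on S (\<lambda>x. \<chi> j. if j = i then g x else (0::complex))"
  proof (rule continuous_on_vec_lambda)
    fix j show "continuous_on S (\<lambda>x. if j = i then g x else 0)"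
      using g by (cases "j = i") auto
  qed
  ultimately show ?thesis by (simp only:)
qed

text \<open>
  Differentiation under the integral sign needs the derivative in \<open>x\<close> to be jointly continuous in
  \<open>(x, \<tau>)\<close>. Joint continuity of \<open>k\<close> alone suffices, because by Cauchy's formula the partial
  derivatives are themselves integrals of \<open>k\<close> over circles of a fixed radius.
\<close>

lemma complex_differentiable_at_integral:
  fixes k :: "complex^'i \<Rightarrow> real \<Rightarrow> complex"
  assumes U: "open U" and cont: "continuous_on (U \<times> {0..1}) (\<lambda>(x, \<tau>). k x \<tau>)"
    and hol: "\<And>x \<tau>. x \<in> U \<Longrightarrow> \<tau> \<in> {0..1} \<Longrightarrow> complex_differentiable_at (\<lambda>x. k x \<tau>) x"
    and x0: "x0 \<in> U"
  shows "complex_differentiable_at (\<lambda>x. integral {0..1} (k x)) x0"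
proof -
  obtain R where R: "R > 0" "cball x0 R \<subseteq> U"
    using U x0 open_contains_cball by blast
  define r where "r = R / 2"
  have r: "r > 0" using R by (simp add: r_def)
  define V where "V = ball x0 r"
  have V: "x + s *s axis i 1 \<in> U" if "x \<in> V" "norm s \<le> r" for x s i
    using add_scaled_axis_in_cball[of x x0 r s i] that R(2) unfolding V_def r_def by auto
  have VU: "V \<subseteq> U" using V[where s = 0] r by auto
  let ?c = "circlepath 0 r"
  have c: "norm (?c \<theta>) = r" for \<theta> using r by (simp add: circlepath norm_mult)
  \<comment> \<open>The partial derivatives of \<open>k\<close> in \<open>x\<close>, in the form in which their continuity is visible.\<close>
  define P where "P i x \<tau> = integral {0..1} (\<lambda>\<theta>. k (x + ?c \<theta> *s axis i 1) \<tau> / ?c \<theta>)" for i x \<tau>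
  have P: "partial_deriv i (\<lambda>x. k x \<tau>) x = P i x \<tau>" if "x \<in> V" "\<tau> \<in> {0..1}" for i x \<tau>
    unfolding P_def by (rule partial_deriv_eq_integral[OF r]) (use V hol that in auto)
  have contP: "continuous_on (V \<times> {0..1}) (\<lambda>(x, \<tau>). P i x \<tau>)" for i
  proof -
    have c0: "continuous_on UNIV ?c" unfolding circlepath by (intro continuous_intros)
    have "continuous_on ((V \<times> {0..1}) \<times> cbox 0 1)
        (\<lambda>(z, \<theta>). k (fst z + ?c \<theta> *s axis i 1) (snd z) / ?c \<theta>)"
      unfolding split_beta
    proof (rule continuous_on_divide)
      show "continuous_on ((V \<times> {0..1}) \<times> cbox 0 1)
          (\<lambda>z. k (fst (fst z) + ?c (snd z) *s axis i 1) (snd (fst z)))"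
        by (rule continuous_on_compose2[OF cont[unfolded split_beta], where f="\<lambda>z.
              (fst (fst z) + ?c (snd z) *s axis i 1, snd (fst z))", unfolded fst_conv snd_conv])
           (use V c in \<open>auto intro!: continuous_intros continuous_on_compose2[OF c0]\<close>)
      show "continuous_on ((V \<times> {0..1}) \<times> cbox 0 1) (\<lambda>z. ?c (snd z))"
        by (rule continuous_on_compose2[OF c0]) (auto intro!: continuous_intros)
      show "\<forall>z\<in>(V \<times> {0..1}) \<times> cbox 0 1. ?c (snd z) \<noteq> 0"
        using c r by (metis norm_zero less_irrefl)
    qed
    from integral_continuous_on_param[OF this]
    show ?thesis unfolding P_def split_beta by (simp add: cbox_interval)
  qed
  define D where "D x \<tau> v = (\<Sum>i\<in>UNIV. v $ i * P i x \<tau>)" for x \<tau> and v :: "complex^'i"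
  have bl: "bounded_linear (D x \<tau>)" for x \<tau>
    unfolding D_def
    by (intro bounded_linear_sum bounded_linear_mult_const bounded_linear_vec_nth)
  define fx where "fx x \<tau> = Blinfun (D x \<tau>)" for x \<tau>
  have fx: "blinfun_apply (fx x \<tau>) = D x \<tau>" for x \<tau>
    unfolding fx_def by (rule bounded_linear_Blinfun_apply[OF bl])
  have contfx: "continuous_on (V \<times> cbox 0 1) (\<lambda>(x, \<tau>). fx x \<tau>)"
    unfolding split_beta
    by (rule continuous_on_blinfun_componentwise)
       (use contP in \<open>auto simp: fx D_def split_beta cbox_interval intro!: continuous_intros\<close>)
  have "((\<lambda>x. integral (cbox 0 1) (k x)) has_derivative integral (cbox 0 1) (fx x0)) (at x0 within V)"
  proof (rule leibniz_rule[OF _ _ contfx])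
    show "((\<lambda>x. k x \<tau>) has_derivative blinfun_apply (fx x \<tau>)) (at x within V)"
      if "x \<in> V" "\<tau> \<in> cbox 0 1" for x \<tau>
    proof -
      have "((\<lambda>x. k x \<tau>) has_derivative D x \<tau>) (at x)"
        using complex_differentiable_at_has_derivative[OF hol, of x \<tau>] that P VU
        unfolding D_def by (auto simp: cbox_interval)
      then show ?thesis by (simp add: fx has_derivative_at_withinI)
    qed
    show "k x integrable_on cbox 0 1" if "x \<in> V" for x
    proof (rule integrable_continuous)
      show "continuous_on (cbox 0 1) (k x)"
        by (rule continuous_on_compose2[OF cont[unfolded split_beta], where f="\<lambda>\<tau>. (x, \<tau>)",
              unfolded fst_conv snd_conv])
           (use that VU in \<open>auto intro!: continuous_intros\<close>)
    qed
  qed (use r in \<open>auto simp: V_def\<close>)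
  then have der: "((\<lambda>x. integral {0..1} (k x)) has_derivative integral (cbox 0 1) (fx x0)) (at x0)"
    using r at_within_open[of x0 V] by (simp add: V_def cbox_interval)
  have "continuous_on (cbox 0 1) (fx x0)"
    by (rule continuous_on_compose2[OF contfx[unfolded split_beta], where f="\<lambda>\<tau>. (x0, \<tau>)",
              unfolded fst_conv snd_conv])
       (use r in \<open>auto simp: V_def intro!: continuous_intros\<close>)
  then have int: "fx x0 integrable_on {0..1}"
    using integrable_continuous by (fastforce simp: cbox_interval)
  have "D x0 \<tau> (a *s v) = a * D x0 \<tau> v" for a v \<tau>
    by (simp add: D_def sum_distrib_left mult.assoc)
  then have "\<forall>a v. blinfun_apply (integral (cbox 0 1) (fx x0)) (a *s v) =
      a * blinfun_apply (integral (cbox 0 1) (fx x0)) v"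
    by (simp add: blinfun_apply_integral[OF int] fx cbox_interval)
  with der show ?thesis unfolding complex_differentiable_at_def by blast
qed

lemma hol_at_eq_open: "hol_at f p \<longleftrightarrow> (\<exists>U. open U \<and> p \<in> U \<and> (\<forall>x\<in>U. complex_differentiable_at f x))"
  by (auto simp: hol_at_def eventually_nhds)

text \<open>
  The integrand in Cauchy's formula is holomorphic in the centre of the circle.
\<close>

lemma hol_at_partial_deriv:
  assumes "hol_at f p" shows "hol_at (partial_deriv i f) p"
proof -
  obtain U where U: "open U" "p \<in> U" "\<And>x. x \<in> U \<Longrightarrow> complex_differentiable_at f x"
    using assms unfolding hol_at_eq_open by blast
  obtain R where R: "R > 0" "cball p R \<subseteq> U"
    using U open_contains_cball by blast
  define r where "r = R / 2"
  have r: "r > 0" using R by (simp add: r_def)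
  define V where "V = ball p r"
  have V: "x + s *s axis i 1 \<in> U" if "x \<in> V" "norm s \<le> r" for x s
    using add_scaled_axis_in_cball[of x p r s i] that R(2) unfolding V_def r_def by auto
  let ?c = "circlepath 0 r"
  have c: "norm (?c \<theta>) = r" for \<theta> using r by (simp add: circlepath norm_mult)
  have c0: "continuous_on UNIV ?c" unfolding circlepath by (intro continuous_intros)
  have contf: "continuous_on U f"
    using U complex_differentiable_at_imp_isCont continuous_at_imp_continuous_on by blast
  let ?P = "\<lambda>x. integral {0..1} (\<lambda>\<theta>. f (x + ?c \<theta> *s axis i 1) / ?c \<theta>)"
  have "complex_differentiable_at ?P x" if "x \<in> V" for x
  proof (rule complex_differentiable_at_integral[of V])
    have nz: "\<forall>z\<in>V \<times> {0..1}. ?c (snd z) \<noteq> 0" using c r by (metis norm_zero less_irrefl)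
    show "continuous_on (V \<times> {0..1}) (\<lambda>(x, \<theta>). f (x + ?c \<theta> *s axis i 1) / ?c \<theta>)"
      unfolding split_beta
      by (intro continuous_on_divide nz continuous_on_compose2[OF contf] continuous_intros
            continuous_on_compose2[OF c0]) (use V c in auto)
    show "complex_differentiable_at (\<lambda>x. f (x + ?c \<theta> *s axis i 1) / ?c \<theta>) x"
      if "x \<in> V" "\<theta> \<in> {0..1}" for x \<theta>
    proof -
      have "complex_differentiable_at (\<lambda>x. f (x + ?c \<theta> *s axis i 1)) x"
        by (rule complex_differentiable_at_compose)
           (use U V c that in \<open>auto intro!: complex_differentiable_at_add\<close>)
      from complex_differentiable_at_mult[OF this complex_differentiable_at_const[of "1 / ?c \<theta>"]]
      show ?thesis by simp
    qed
  qed (use that in \<open>auto simp: V_def\<close>)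
  then have "hol_at ?P p"
    unfolding hol_at_eq_open using r by (intro exI[of _ V]) (auto simp: V_def)
  moreover have "?P x = partial_deriv i f x" if "x \<in> V" for x
    by (rule partial_deriv_eq_integral[OF r, symmetric]) (use U V that in auto)
  then have "\<forall>\<^sub>F x in nhds p. ?P x = partial_deriv i f x"
    unfolding eventually_nhds using r by (intro exI[of _ V]) (auto simp: V_def)
  ultimately show ?thesis by (rule hol_at_cong)
qed

text \<open>
  Hadamard's lemma in a relative form: integrate the derivative of \<open>f\<close> along the segment from \<open>b x\<close> to
  \<open>a x\<close>. The common base value keeps these segments, for \<open>x\<close> near \<open>p\<close>, inside the domain of \<open>f\<close>.
  The lemma turns the vanishing of \<open>f\<close> along \<open>b\<close> into membership of \<open>f \<circ> a\<close> in the ideal generated by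
  the components of \<open>a - b\<close>.
\<close>

lemma hadamard_lemma:
  fixes a b :: "complex^'i \<Rightarrow> complex^'j"
  assumes f: "hol_at f q"
    and a: "\<And>j. hol_at (\<lambda>x. a x $ j) p" "a p = q" and b: "\<And>j. hol_at (\<lambda>x. b x $ j) p" "b p = q"
  obtains h where "\<And>j. hol_at (h j) p"
    "\<forall>\<^sub>F x in nhds p. f (a x) - f (b x) = (\<Sum>j\<in>UNIV. (a x $ j - b x $ j) * h j x)"
proof -
  have "\<forall>\<^sub>F y in nhds q. complex_differentiable_at f y \<and>
      (\<forall>j. complex_differentiable_at (partial_deriv j f) y)"
    using f hol_at_partial_deriv[OF f] unfolding hol_at_def
    by (simp add: eventually_conj_iff eventually_all_finite)
  then obtain \<rho> where \<rho>: "\<rho> > 0" "\<And>y. y \<in> ball q \<rho> \<Longrightarrow> complex_differentiable_at f y"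
      "\<And>y j. y \<in> ball q \<rho> \<Longrightarrow> complex_differentiable_at (partial_deriv j f) y"
    unfolding eventually_nhds_metric by (auto simp: dist_commute)
  have "\<forall>\<^sub>F y in nhds q. y \<in> ball q \<rho>" by (rule eventually_nhds_in_open) (use \<rho>(1) in auto)
  from eventually_compose_nhds[OF isCont_vec[OF a(1)], of "\<lambda>y. y \<in> ball q \<rho>"]
    eventually_compose_nhds[OF isCont_vec[OF b(1)], of "\<lambda>y. y \<in> ball q \<rho>"] this
  have "\<forall>\<^sub>F x in nhds p. a x \<in> ball q \<rho>" "\<forall>\<^sub>F x in nhds p. b x \<in> ball q \<rho>"
    unfolding a(2) b(2) by blast+
  then have "\<forall>\<^sub>F x in nhds p. (a x \<in> ball q \<rho> \<and> b x \<in> ball q \<rho>) \<and>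
      (\<forall>j. complex_differentiable_at (\<lambda>x. a x $ j) x) \<and> (\<forall>j. complex_differentiable_at (\<lambda>x. b x $ j) x)"
    using a(1) b(1) unfolding hol_at_def
    by (simp add: eventually_conj_iff eventually_all_finite del: mem_ball)
  then obtain U where U: "open U" "p \<in> U"
    and ab: "\<And>x. x \<in> U \<Longrightarrow> a x \<in> ball q \<rho>" "\<And>x. x \<in> U \<Longrightarrow> b x \<in> ball q \<rho>"
    and cda: "\<And>x j. x \<in> U \<Longrightarrow> complex_differentiable_at (\<lambda>x. a x $ j) x"
    and cdb: "\<And>x j. x \<in> U \<Longrightarrow> complex_differentiable_at (\<lambda>x. b x $ j) x"
    unfolding eventually_nhds by blast
  define l where "l x \<tau> = b x + \<tau> *\<^sub>R (a x - b x)" for x \<tau>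
  have l: "l x \<tau> \<in> ball q \<rho>" if "x \<in> U" "\<tau> \<in> {0..1}" for x \<tau>
  proof -
    have "l x \<tau> = (1 - \<tau>) *\<^sub>R b x + \<tau> *\<^sub>R a x" by (simp add: l_def algebra_simps)
    then show ?thesis using convexD[OF convex_ball ab(2)[OF that(1)] ab(1)[OF that(1)], of "1 - \<tau>" \<tau>] that(2)
      by auto
  qed
  have "isCont a x" "isCont b x" if "x \<in> U" for x
    using complex_differentiable_at_imp_isCont[OF cda[OF that]]
      complex_differentiable_at_imp_isCont[OF cdb[OF that]]
    unfolding isCont_def by (auto intro: vec_tendstoI)
  then have conta: "continuous_on U a" "continuous_on U b"
    by (auto intro!: continuous_at_imp_continuous_on)
  have contl: "continuous_on (U \<times> {0..1}) (\<lambda>z. l (fst z) (snd z))"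
    unfolding l_def
    by (auto intro!: continuous_intros continuous_on_compose2[OF conta(1)] continuous_on_compose2[OF conta(2)])
  have contp: "continuous_on (ball q \<rho>) (partial_deriv j f)" for j
    using \<rho>(3) complex_differentiable_at_imp_isCont continuous_at_imp_continuous_on by blast
  define h where "h j x = integral {0..1} (\<lambda>\<tau>. partial_deriv j f (l x \<tau>))" for j x
  have contk: "continuous_on (U \<times> {0..1}) (\<lambda>(x, \<tau>). partial_deriv j f (l x \<tau>))" for j
    unfolding split_beta by (rule continuous_on_compose2[OF contp contl]) (use l in auto)
  have cdl: "complex_differentiable_at (\<lambda>x. l x \<tau> $ j) x" if "x \<in> U" for x \<tau> j
  proof -
    have "complex_differentiable_at (\<lambda>x. b x $ j + of_real \<tau> * (a x $ j - b x $ j)) x"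
      using cda cdb that
      by (intro complex_differentiable_at_add complex_differentiable_at_mult complex_differentiable_at_diff) auto
    then show ?thesis by (simp add: l_def scaleR_conv_of_real[where 'a = complex])
  qed
  have cdh: "complex_differentiable_at (h j) x" if "x \<in> U" for j x
    unfolding h_def
  proof (rule complex_differentiable_at_integral[OF U(1) contk _ that])
    fix y \<tau> assume y: "y \<in> U" and \<tau>: "\<tau> \<in> {0..1::real}"
    show "complex_differentiable_at (\<lambda>x. partial_deriv j f (l x \<tau>)) y"
      by (rule complex_differentiable_at_compose[where g = "\<lambda>x. l x \<tau>", OF \<rho>(3)[OF l[OF y \<tau>]] cdl[OF y]])
  qed
  show ?thesis
  proof
    show "hol_at (h j) p" for j
      unfolding hol_at_eq_open using U cdh by blast
    have "f (a x) - f (b x) = (\<Sum>j\<in>UNIV. (a x $ j - b x $ j) * h j x)" if x: "x \<in> U" for x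
    proof -
      have "((\<lambda>\<tau>. f (l x \<tau>)) has_vector_derivative
          (\<Sum>j\<in>UNIV. (a x $ j - b x $ j) * partial_deriv j f (l x \<tau>))) (at \<tau> within {0..1})"
        if "\<tau> \<in> {0..1}" for \<tau>
      proof -
        have "((\<lambda>\<tau>. l x \<tau>) has_derivative (\<lambda>s. s *\<^sub>R (a x - b x))) (at \<tau> within {0..1})"
          unfolding l_def by (auto intro!: derivative_eq_intros)
        from has_derivative_compose[OF this complex_differentiable_at_has_derivative[OF \<rho>(2)[OF l[OF x that]]]]
        have "((\<lambda>\<tau>. f (l x \<tau>)) has_derivative
            (\<lambda>s. \<Sum>j\<in>UNIV. (s *\<^sub>R (a x - b x)) $ j * partial_deriv j f (l x \<tau>))) (at \<tau> within {0..1})" .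
        then show ?thesis
          by (simp add: has_vector_derivative_def scaleR_sum_right)
      qed
      then have "((\<lambda>\<tau>. \<Sum>j\<in>UNIV. (a x $ j - b x $ j) * partial_deriv j f (l x \<tau>)) has_integral
          f (l x 1) - f (l x 0)) {0..1}"
        by (intro fundamental_theorem_of_calculus) auto
      then have "f (a x) - f (b x) =
          integral {0..1} (\<lambda>\<tau>. \<Sum>j\<in>UNIV. (a x $ j - b x $ j) * partial_deriv j f (l x \<tau>))"
        by (simp add: integral_unique l_def)
      also have "\<dots> = (\<Sum>j\<in>UNIV. integral {0..1} (\<lambda>\<tau>. (a x $ j - b x $ j) * partial_deriv j f (l x \<tau>)))"
      proof (rule integral_sum)
        fix j
        have "continuous_on {0..1} (\<lambda>\<tau>. partial_deriv j f (l x \<tau>))"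
          by (rule continuous_on_compose2[OF contk[unfolded split_beta], where f="\<lambda>\<tau>. (x, \<tau>)",
                unfolded fst_conv snd_conv]) (use x in \<open>auto intro!: continuous_intros\<close>)
        then show "(\<lambda>\<tau>. (a x $ j - b x $ j) * partial_deriv j f (l x \<tau>)) integrable_on {0..1}"
          by (intro integrable_continuous_interval continuous_intros)
      qed simp
      finally show ?thesis by (simp add: h_def)
    qed
    then show "\<forall>\<^sub>F x in nhds p. f (a x) - f (b x) = (\<Sum>j\<in>UNIV. (a x $ j - b x $ j) * h j x)"
      unfolding eventually_nhds using U by blast
  qed
qed

section \<open>Linear terms\<close>

lemma partial_deriv_DERIV:
  assumes "complex_differentiable_at f x"
  shows "((\<lambda>s. f (x + s *s axis i 1)) has_field_derivative partial_deriv i f x) (at 0)"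
proof -
  obtain D where D: "(f has_derivative D) (at x)" "\<And>c v. D (c *s v) = c * D v"
    using assms unfolding complex_differentiable_at_def by blast
  show ?thesis
    unfolding partial_deriv_eqI[OF D]
    by (rule has_field_derivative_on_complex_line) (use D in auto)
qed

lemma partial_deriv_cong:
  assumes "\<forall>\<^sub>F y in nhds x. f y = g y" shows "partial_deriv i f x = partial_deriv i g x"
  unfolding partial_deriv_def
proof (rule deriv_cong_ev)
  have "isCont (\<lambda>s. x + s *s axis i 1) 0"
    by (rule has_derivative_continuous[OF complex_line_has_derivative])
  from eventually_compose_nhds[OF this, of "\<lambda>y. f y = g y"] assms
  show "\<forall>\<^sub>F s in nhds 0. f (x + s *s axis i 1) = g (x + s *s axis i 1)" by simp
qed simp

lemma partial_deriv_const [simp]: "partial_deriv i (\<lambda>_. c) x = 0"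
  by (simp add: partial_deriv_def)

lemma partial_deriv_add:
  assumes "complex_differentiable_at f x" "complex_differentiable_at g x"
  shows "partial_deriv i (\<lambda>x. f x + g x) x = partial_deriv i f x + partial_deriv i g x"
  using DERIV_add[OF partial_deriv_DERIV[OF assms(1)] partial_deriv_DERIV[OF assms(2)], of i]
  by (simp add: partial_deriv_def DERIV_imp_deriv)

lemma partial_deriv_mult:
  assumes "complex_differentiable_at f x" "complex_differentiable_at g x"
  shows "partial_deriv i (\<lambda>x. f x * g x) x = partial_deriv i f x * g x + f x * partial_deriv i g x"
  using DERIV_mult[OF partial_deriv_DERIV[OF assms(1), of i] partial_deriv_DERIV[OF assms(2), of i]]
  by (simp add: partial_deriv_def[of i "\<lambda>x. f x * g x"] DERIV_imp_deriv algebra_simps)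

lemma partial_deriv_compose:
  fixes g :: "complex^'i \<Rightarrow> complex^'j"
  assumes f: "complex_differentiable_at f (g x)"
    and g: "\<And>j. complex_differentiable_at (\<lambda>x. g x $ j) x"
  shows "partial_deriv i (\<lambda>x. f (g x)) x =
    (\<Sum>j\<in>UNIV. partial_deriv i (\<lambda>x. g x $ j) x * partial_deriv j f (g x))"
proof -
  let ?E = "\<lambda>v. \<chi> j. \<Sum>i\<in>UNIV. v $ i * partial_deriv i (\<lambda>x. g x $ j) x"
  have "(g has_derivative ?E) (at x)"
    using has_derivative_vec_lambda[OF complex_differentiable_at_has_derivative[OF g], of "\<lambda>j. j"]
    by simp
  from has_derivative_compose[OF this complex_differentiable_at_has_derivative[OF f]]
  have D: "((\<lambda>x. f (g x)) has_derivative (\<lambda>v. \<Sum>j\<in>UNIV. ?E v $ j * partial_deriv j f (g x))) (at x)" .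
  have "partial_deriv i (\<lambda>x. f (g x)) x = (\<Sum>j\<in>UNIV. ?E (axis i 1) $ j * partial_deriv j f (g x))"
    by (rule partial_deriv_eqI[OF D]) (simp add: sum_distrib_left sum_distrib_right mult.assoc)
  moreover have "?E (axis i 1) $ j = partial_deriv i (\<lambda>x. g x $ j) x" for j
    by (simp add: axis_def if_distrib[of "\<lambda>c. c * _"] cong: if_cong)
  ultimately show ?thesis by simp
qed

lemma gradient_combination:
  assumes "finite K" "\<And>k. k \<in> K \<Longrightarrow> hol_at (h k) p" "\<And>k. k \<in> K \<Longrightarrow> hol_at (e k) p"
    and "\<And>k. k \<in> K \<Longrightarrow> e k p = 0"
  shows "gradient (\<lambda>x. \<Sum>k\<in>K. h k x * e k x) p = (\<Sum>k\<in>K. h k p *s gradient (e k) p)"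
  using assms
proof (induction K rule: finite_induct)
  case empty
  then show ?case by (simp add: gradient_def Finite_Cartesian_Product.vec_eq_iff)
next
  case (insert k K)
  have cd: "complex_differentiable_at (h k) p" "complex_differentiable_at (e k) p"
    using insert.prems by (auto intro: hol_at_imp_complex_differentiable_at)
  have "complex_differentiable_at (\<lambda>x. \<Sum>k\<in>K. h k x * e k x) p"
    using insert.prems by (intro hol_at_imp_complex_differentiable_at hol_at_sum hol_at_mult) auto
  note pd = partial_deriv_add[OF complex_differentiable_at_mult[OF cd] this]
    partial_deriv_mult[OF cd]
  show ?case using insert
    by (simp add: gradient_def Finite_Cartesian_Product.vec_eq_iff pd)
qed

section \<open>Ideals of germs\<close>

lemma germ_ideal_hol: "f \<in> germ_ideal p G \<Longrightarrow> hol_at f p"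
  by (simp add: germ_ideal_def)

text \<open>
  In the definition of the ideal the coefficients are attached to the generators themselves. A
  combination that is indexed differently, possibly with repetitions, is brought into this form by
  collecting the terms with the same generator.
\<close>

lemma germ_idealI:
  assumes "finite K" "\<And>k. k \<in> K \<Longrightarrow> e k \<in> G" "\<And>k. k \<in> K \<Longrightarrow> hol_at (c k) p" "hol_at f p"
    and "\<forall>\<^sub>F x in nhds p. f x = (\<Sum>k\<in>K. c k x * e k x)"
  shows "f \<in> germ_ideal p G"
proof -
  have "(\<Sum>k\<in>K. c k x * e k x) = (\<Sum>g\<in>e ` K. (\<Sum>k\<in>{k\<in>K. e k = g}. c k x) * g x)" for x
  proof -
    have "(\<Sum>k\<in>K. c k x * e k x) = (\<Sum>g\<in>e ` K. \<Sum>k\<in>{k\<in>K. e k = g}. c k x * e k x)"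
      by (rule sum.image_gen[OF assms(1)])
    also have "\<dots> = (\<Sum>g\<in>e ` K. \<Sum>k\<in>{k\<in>K. e k = g}. c k x * g x)"
      by (intro sum.cong) auto
    finally show ?thesis by (simp add: sum_distrib_right)
  qed
  then show ?thesis
    unfolding germ_ideal_def using assms
    by (intro CollectI conjI exI[of _ "e ` K"] exI[of _ "\<lambda>g x. \<Sum>k\<in>{k\<in>K. e k = g}. c k x"]) auto
qed

lemma germ_ideal_cong:
  assumes "f \<in> germ_ideal p G" "\<forall>\<^sub>F x in nhds p. f x = g x" shows "g \<in> germ_ideal p G"
proof -
  obtain S h where S: "finite S" "S \<subseteq> G" "\<And>g. g \<in> S \<Longrightarrow> hol_at (h g) p"
      "\<forall>\<^sub>F x in nhds p. f x = (\<Sum>g\<in>S. h g x * g x)"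
    using assms(1) unfolding germ_ideal_def by blast
  have "\<forall>\<^sub>F x in nhds p. g x = (\<Sum>g\<in>S. h g x * g x)"
    using assms(2) S(4) by eventually_elim simp
  moreover have "hol_at g p"
    using assms hol_at_cong unfolding germ_ideal_def by blast
  ultimately show ?thesis
    by (intro germ_idealI[OF S(1) _ S(3), of "\<lambda>g. g"]) (use S(2) in auto)
qed

lemma germ_ideal_base: "g \<in> G \<Longrightarrow> hol_at g p \<Longrightarrow> g \<in> germ_ideal p G"
  by (rule germ_idealI[of "{()}" "\<lambda>_. g" _ "\<lambda>_ _. 1"]) auto

lemma germ_ideal_zero: "(\<lambda>_. 0) \<in> germ_ideal p G"
  by (rule germ_idealI[of "{}"]) auto

lemma germ_ideal_add:
  assumes "f \<in> germ_ideal p G" "g \<in> germ_ideal p G"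
  shows "(\<lambda>x. f x + g x) \<in> germ_ideal p G"
proof -
  obtain S h where S: "finite S" "S \<subseteq> G" "\<forall>g\<in>S. hol_at (h g) p"
      "\<forall>\<^sub>F x in nhds p. f x = (\<Sum>g\<in>S. h g x * g x)"
    using assms(1) unfolding germ_ideal_def by blast
  obtain T k where T: "finite T" "T \<subseteq> G" "\<forall>g\<in>T. hol_at (k g) p"
      "\<forall>\<^sub>F x in nhds p. g x = (\<Sum>g\<in>T. k g x * g x)"
    using assms(2) unfolding germ_ideal_def by blast
  have "\<forall>\<^sub>F x in nhds p. f x + g x =
      (\<Sum>z\<in>S <+> T. (case z of Inl g \<Rightarrow> h g | Inr g \<Rightarrow> k g) x * (case z of Inl g \<Rightarrow> g | Inr g \<Rightarrow> g) x)"
    using S(4) T(4) by eventually_elim (simp add: sum.Plus S(1) T(1))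
  then show ?thesis
    by (intro germ_idealI[of "S <+> T"]) (use S T assms in \<open>auto dest: germ_ideal_hol\<close>)
qed

lemma germ_ideal_mult:
  assumes "f \<in> germ_ideal p G" "hol_at c p"
  shows "(\<lambda>x. c x * f x) \<in> germ_ideal p G"
proof -
  obtain S h where S: "finite S" "S \<subseteq> G" "\<forall>g\<in>S. hol_at (h g) p"
      "\<forall>\<^sub>F x in nhds p. f x = (\<Sum>g\<in>S. h g x * g x)"
    using assms(1) unfolding germ_ideal_def by blast
  have "\<forall>\<^sub>F x in nhds p. c x * f x = (\<Sum>g\<in>S. (c x * h g x) * g x)"
    using S(4) by eventually_elim (simp add: sum_distrib_left mult.assoc)
  then show ?thesis
    by (intro germ_idealI[of S "\<lambda>g. g"]) (use S assms in \<open>auto dest: germ_ideal_hol\<close>)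
qed

lemma germ_ideal_combination:
  assumes "finite K" "\<And>k. k \<in> K \<Longrightarrow> hol_at (c k) p" "\<And>k. k \<in> K \<Longrightarrow> f k \<in> germ_ideal p G"
  shows "(\<lambda>x. \<Sum>k\<in>K. c k x * f k x) \<in> germ_ideal p G"
  using assms
  by (induction K rule: finite_induct) (auto intro!: germ_ideal_zero germ_ideal_add germ_ideal_mult)

lemma germ_ideal_mono:
  assumes "\<And>g. g \<in> G \<Longrightarrow> g \<in> germ_ideal p H" shows "germ_ideal p G \<subseteq> germ_ideal p H"
proof
  fix f assume "f \<in> germ_ideal p G"
  then obtain S h where S: "finite S" "S \<subseteq> G" "\<forall>g\<in>S. hol_at (h g) p"
      "\<forall>\<^sub>F x in nhds p. f x = (\<Sum>g\<in>S. h g x * g x)"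
    unfolding germ_ideal_def by blast
  have "(\<lambda>x. \<Sum>g\<in>S. h g x * g x) \<in> germ_ideal p H"
    using S assms by (intro germ_ideal_combination) auto
  moreover have "\<forall>\<^sub>F x in nhds p. (\<Sum>g\<in>S. h g x * g x) = f x"
    using S(4) by eventually_elim simp
  ultimately show "f \<in> germ_ideal p H" by (rule germ_ideal_cong)
qed

lemma germ_ideal_image_elim:
  assumes "f \<in> germ_ideal p (e ` K)" "finite K"
  obtains b where "\<And>k. hol_at (b k) p" "\<forall>\<^sub>F x in nhds p. f x = (\<Sum>k\<in>K. b k x * e k x)"
proof -
  obtain S h where S: "finite S" "S \<subseteq> e ` K" "\<forall>g\<in>S. hol_at (h g) p"
      "\<forall>\<^sub>F x in nhds p. f x = (\<Sum>g\<in>S. h g x * g x)"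
    using assms(1) unfolding germ_ideal_def by blast
  from S(2) have "\<forall>g\<in>S. \<exists>k. k \<in> K \<and> e k = g" by blast
  then obtain i where i: "\<And>g. g \<in> S \<Longrightarrow> i g \<in> K \<and> e (i g) = g" by metis
  define b where "b k x = (\<Sum>g\<in>S. (if i g = k then h g x else 0))" for k x
  have "(\<Sum>k\<in>K. b k x * e k x) = (\<Sum>g\<in>S. h g x * g x)" for x
  proof -
    have "(\<Sum>k\<in>K. b k x * e k x) = (\<Sum>g\<in>S. \<Sum>k\<in>K. (if k = i g then h g x * e k x else 0))"
      unfolding b_def sum_distrib_right by (subst sum.swap) (intro sum.cong, auto)
    also have "\<dots> = (\<Sum>g\<in>S. h g x * g x)"
      using i assms(2) by (intro sum.cong) auto
    finally show ?thesis .
  qed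
  moreover have "hol_at (b k) p" for k
    unfolding b_def
  proof (rule hol_at_sum)
    fix g assume "g \<in> S"
    then show "hol_at (\<lambda>x. if i g = k then h g x else 0) p"
      using S(3) by (cases "i g = k") auto
  qed
  ultimately show thesis using that[of b] S(4) by simp
qed

section \<open>Smoothness\<close>

text \<open>
  A form of Nakayama's lemma. The assumption on \<open>J\<close> says that \<open>J \<inter> M\<^sup>2 \<subseteq> M J\<close>, where \<open>M\<close> is the maximal
  ideal at \<open>p\<close>. Consider a subset of the generators that generates \<open>J\<close> and is as small as possible. If
  its differentials were dependent, then a linear combination with a non-zero coefficient at some
  generator would lie in \<open>M J\<close>; solving for that generator, whose coefficient is a unit, would make it
  superfluous.
\<close>

lemma smooth_at_criterion:
  fixes e :: "nat \<Rightarrow> complex^'i \<Rightarrow> complex"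
  assumes e: "\<And>k. k < c \<Longrightarrow> hol_at (e k) p" "\<And>k. k < c \<Longrightarrow> e k p = 0"
    and J: "J = germ_ideal p (e ` {..<c})"
    and P: "\<And>f. f \<in> J \<Longrightarrow> gradient f p = 0 \<Longrightarrow>
      \<exists>(L :: nat set) \<phi> \<psi>. finite L \<and> (\<forall>j\<in>L. hol_at (\<phi> j) p \<and> \<phi> j p = 0 \<and> \<psi> j \<in> J) \<and>
        (\<forall>\<^sub>F x in nhds p. f x = (\<Sum>j\<in>L. \<phi> j x * \<psi> j x))"
  shows "smooth_at p J"
proof -
  define Q where "Q K \<longleftrightarrow> K \<subseteq> {..<c} \<and> J = germ_ideal p (e ` K)" for K
  have "Q {..<c}" using J by (simp add: Q_def)
  then obtain K where K: "Q K" and min: "\<And>K'. Q K' \<Longrightarrow> card K \<le> card K'"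
    using ex_has_least_nat[of Q "{..<c}" card] by blast
  have Kc: "K \<subseteq> {..<c}" and JK: "J = germ_ideal p (e ` K)" using K by (auto simp: Q_def)
  have finK: "finite K" using Kc finite_subset by blast
  have eK: "hol_at (e k) p" "e k p = 0" if "k \<in> K" for k using that Kc e by auto
  have indep: "a l = 0" if a: "(\<Sum>k\<in>K. a k *s gradient (e k) p) = 0" and l: "l \<in> K" for a l
  proof (rule ccontr)
    assume al: "a l \<noteq> 0"
    define f where "f = (\<lambda>x. \<Sum>k\<in>K. a k * e k x)"
    have fJ: "f \<in> J" unfolding JK f_def
      using eK by (intro germ_ideal_combination finK germ_ideal_base) auto
    have "gradient f p = 0"
      using gradient_combination[of K "\<lambda>k _. a k" p e] finK eK a by (simp add: f_def)
    from P[OF fJ this] obtain L :: "nat set" and \<phi> \<psi> where L: "finite L"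
        "\<forall>j\<in>L. hol_at (\<phi> j) p \<and> \<phi> j p = 0 \<and> \<psi> j \<in> J"
        "\<forall>\<^sub>F x in nhds p. f x = (\<Sum>j\<in>L. \<phi> j x * \<psi> j x)"
      by (elim exE conjE) (rule that; assumption)
    have "\<exists>b. (\<forall>k. hol_at (b k) p) \<and> (\<forall>\<^sub>F x in nhds p. \<psi> j x = (\<Sum>k\<in>K. b k x * e k x))"
      if "j \<in> L" for j
    proof -
      have "\<psi> j \<in> germ_ideal p (e ` K)" using L(2) that JK by blast
      then obtain b where "\<And>k. hol_at (b k) p" "\<forall>\<^sub>F x in nhds p. \<psi> j x = (\<Sum>k\<in>K. b k x * e k x)"
        using finK by (rule germ_ideal_image_elim) blast
      then show ?thesis by blast
    qed
    then have "\<exists>b. \<forall>j\<in>L. (\<forall>k. hol_at (b j k) p) \<and>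
        (\<forall>\<^sub>F x in nhds p. \<psi> j x = (\<Sum>k\<in>K. b j k x * e k x))"
      by (intro bchoice ballI)
    then obtain b where b: "\<forall>j\<in>L. (\<forall>k. hol_at (b j k) p) \<and>
        (\<forall>\<^sub>F x in nhds p. \<psi> j x = (\<Sum>k\<in>K. b j k x * e k x))" ..
    \<comment> \<open>The relation \<open>\<Sum>k. u k * e k = 0\<close>, in which the coefficient of \<open>e l\<close> is a unit.\<close>
    define u where "u k x = a k - (\<Sum>j\<in>L. \<phi> j x * b j k x)" for k x
    have hu: "hol_at (u k) p" for k
      unfolding u_def using L(2) b by (intro hol_at_diff hol_at_const hol_at_sum hol_at_mult) simp_all
    have ul: "u l p \<noteq> 0" using al L(2) by (simp add: u_def)
    have "\<forall>\<^sub>F x in nhds p. \<forall>j\<in>L. \<psi> j x = (\<Sum>k\<in>K. b j k x * e k x)"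
      using b by (simp add: eventually_ball_finite_distrib L(1))
    then have "\<forall>\<^sub>F x in nhds p. e l x = (\<Sum>k\<in>K - {l}. (- u k x / u l x) * e k x)"
      using L(3) hol_at_imp_eventually_nonzero[OF hu ul]
    proof eventually_elim
      case (elim x)
      have "(\<Sum>k\<in>K. a k * e k x) = (\<Sum>j\<in>L. \<phi> j x * (\<Sum>k\<in>K. b j k x * e k x))"
        using elim(1,2) by (simp add: f_def)
      also have "\<dots> = (\<Sum>k\<in>K. (\<Sum>j\<in>L. \<phi> j x * b j k x) * e k x)"
        unfolding sum_distrib_left sum_distrib_right by (subst sum.swap) (simp add: mult.assoc)
      finally have "(\<Sum>k\<in>K. u k x * e k x) = 0"
        by (simp add: u_def left_diff_distrib sum_subtractf)
      then have "u l x * e l x + (\<Sum>k\<in>K - {l}. u k x * e k x) = 0"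
        using sum.remove[OF finK l, of "\<lambda>k. u k x * e k x"] by simp
      then have *: "u l x * e l x = - (\<Sum>k\<in>K - {l}. u k x * e k x)"
        by (simp add: eq_neg_iff_add_eq_0)
      have "e l x = (u l x * e l x) / u l x" using elim(3) by simp
      then have "e l x = - (\<Sum>k\<in>K - {l}. u k x * e k x) / u l x" by (simp only: *)
      also have "\<dots> = (\<Sum>k\<in>K - {l}. (- u k x / u l x) * e k x)"
        by (simp add: sum_divide_distrib sum_negf)
      finally show ?case .
    qed
    then have el: "e l \<in> germ_ideal p (e ` (K - {l}))"
      by (rule germ_idealI[rotated 4]) (use finK eK l hu ul in \<open>auto intro!: hol_at_divide\<close>)
    have "germ_ideal p (e ` K) = germ_ideal p (e ` (K - {l}))"
    proof (rule equalityI; rule germ_ideal_mono)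
      show "g \<in> germ_ideal p (e ` (K - {l}))" if "g \<in> e ` K" for g
        using that el eK by (cases "g = e l") (auto intro!: germ_ideal_base)
    qed (use eK in \<open>auto intro!: germ_ideal_base\<close>)
    then have "Q (K - {l})" using Kc JK by (auto simp: Q_def)
    from min[OF this] show False using finK l by (metis card_Diff1_less not_less)
  qed
  obtain \<beta> where \<beta>: "bij_betw \<beta> {..<card K} K"
    using ex_bij_betw_nat_finite[OF finK] by (auto simp: atLeast0LessThan)
  show ?thesis unfolding smooth_at_def
  proof (intro exI conjI)
    show "\<forall>k<card K. hol_at (e (\<beta> k)) p \<and> e (\<beta> k) p = 0"
      using \<beta> eK by (auto dest: bij_betwE)
    have "e ` K = e ` (\<beta> ` {..<card K})" using bij_betw_imp_surj_on[OF \<beta>] by simp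
    also have "\<dots> = (\<lambda>k. e (\<beta> k)) ` {..<card K}" by (rule image_image)
    finally show "J = germ_ideal p ((\<lambda>k. e (\<beta> k)) ` {..<card K})" using JK by simp
    show "independent_differentials (card K) (\<lambda>k. e (\<beta> k)) p"
      unfolding independent_differentials_def
    proof (intro allI impI)
      fix a k assume a: "(\<Sum>k<card K. a k *s gradient (e (\<beta> k)) p) = 0" and k: "k < card K"
      let ?\<gamma> = "the_inv_into {..<card K} \<beta>"
      have \<gamma>: "?\<gamma> (\<beta> k) = k" if "k < card K" for k
        using \<beta> that by (simp add: the_inv_into_f_f bij_betw_def)
      have "(\<Sum>k\<in>K. a (?\<gamma> k) *s gradient (e k) p) =
          (\<Sum>k<card K. a (?\<gamma> (\<beta> k)) *s gradient (e (\<beta> k)) p)"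
        by (rule sum.reindex_bij_betw[OF \<beta>, symmetric])
      also have "\<dots> = 0" using a \<gamma> by simp
      finally have "a (?\<gamma> (\<beta> k)) = 0" by (rule indep) (use \<beta> k in \<open>auto dest: bij_betwE\<close>)
      then show "a k = 0" using \<gamma> k by simp
    qed
  qed
qed

text \<open>
  Smoothness descends along an embedding \<open>\<sigma>\<close> with left inverse \<open>\<pi>\<close> under which the two ideals pull back
  into each other. Independent generators \<open>g k\<close> upstairs restrict to generators \<open>g k \<circ> \<sigma>\<close> downstairs, whose
  differentials may be dependent. The criterion above applies nevertheless: if \<open>f\<close> lies downstairs and
  has no linear term, then neither has \<open>f \<circ> \<pi> = \<Sum>k. h k * g k\<close>, so independence upstairs forces the
  coefficients \<open>h k\<close> to vanish at the point, and they still do so after restriction along \<open>\<sigma>\<close>.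
\<close>

lemma smooth_at_retract:
  fixes \<sigma> :: "complex^'i \<Rightarrow> complex^'j" and \<pi> :: "complex^'j \<Rightarrow> complex^'i"
  assumes \<sigma>: "\<And>j. hol_at (\<lambda>y. \<sigma> y $ j) x" and \<pi>: "\<And>i. hol_at (\<lambda>z. \<pi> z $ i) (\<sigma> x)"
    and \<pi>\<sigma>: "\<And>y. \<pi> (\<sigma> y) = y"
    and G: "\<And>g. g \<in> G \<Longrightarrow> hol_at g x"
    and HG: "\<And>f. f \<in> H \<Longrightarrow> (\<lambda>y. f (\<sigma> y)) \<in> germ_ideal x G"
    and GH: "\<And>f. f \<in> G \<Longrightarrow> (\<lambda>z. f (\<pi> z)) \<in> germ_ideal (\<sigma> x) H"
    and smooth: "smooth_at (\<sigma> x) (germ_ideal (\<sigma> x) H)"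
  shows "smooth_at x (germ_ideal x G)"
proof -
  let ?p = "\<sigma> x"
  have pull\<sigma>: "(\<lambda>y. f (\<sigma> y)) \<in> germ_ideal x G" if f: "f \<in> germ_ideal ?p H" for f
  proof -
    obtain S h where S: "finite S" "S \<subseteq> H" "\<forall>g\<in>S. hol_at (h g) ?p"
      "\<forall>\<^sub>F z in nhds ?p. f z = (\<Sum>g\<in>S. h g z * g z)"
      using f unfolding germ_ideal_def by blast
    have "(\<lambda>y. \<Sum>g\<in>S. h g (\<sigma> y) * g (\<sigma> y)) \<in> germ_ideal x G"
      using S HG by (intro germ_ideal_combination hol_at_compose[OF _ \<sigma>]) auto
    moreover have "\<forall>\<^sub>F y in nhds x. (\<Sum>g\<in>S. h g (\<sigma> y) * g (\<sigma> y)) = f (\<sigma> y)"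
      using eventually_compose_nhds[OF isCont_vec[OF \<sigma>] S(4)] by eventually_elim simp
    ultimately show ?thesis by (rule germ_ideal_cong)
  qed
  have pull\<pi>: "(\<lambda>z. f (\<pi> z)) \<in> germ_ideal ?p H" if f: "f \<in> germ_ideal x G" for f
  proof -
    have px: "\<pi> ?p = x" by (rule \<pi>\<sigma>)
    obtain S h where S: "finite S" "S \<subseteq> G" "\<forall>g\<in>S. hol_at (h g) (\<pi> ?p)"
      "\<forall>\<^sub>F y in nhds (\<pi> ?p). f y = (\<Sum>g\<in>S. h g y * g y)"
      using f unfolding germ_ideal_def px by blast
    have "(\<lambda>z. \<Sum>g\<in>S. h g (\<pi> z) * g (\<pi> z)) \<in> germ_ideal ?p H"
      using S GH by (intro germ_ideal_combination hol_at_compose[OF _ \<pi>]) auto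
    moreover have "\<forall>\<^sub>F z in nhds ?p. (\<Sum>g\<in>S. h g (\<pi> z) * g (\<pi> z)) = f (\<pi> z)"
      using eventually_compose_nhds[OF isCont_vec[OF \<pi>] S(4)] by eventually_elim simp
    ultimately show ?thesis by (rule germ_ideal_cong)
  qed
  obtain c g where g: "\<And>k. k < c \<Longrightarrow> hol_at (g k) ?p" "\<And>k. k < c \<Longrightarrow> g k ?p = 0"
    and ind: "independent_differentials c g ?p"
    and H: "germ_ideal ?p H = germ_ideal ?p (g ` {..<c})"
    using smooth unfolding smooth_at_def by blast
  define e where "e k y = g k (\<sigma> y)" for k y
  have eG: "e k \<in> germ_ideal x G" if "k < c" for k
    unfolding e_def by (rule pull\<sigma>) (use that g in \<open>auto simp: H intro!: germ_ideal_base\<close>)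
  have expand: "\<exists>h. (\<forall>k. hol_at (h k) ?p) \<and>
      (\<forall>\<^sub>F z in nhds ?p. f (\<pi> z) = (\<Sum>k<c. h k z * g k z)) \<and>
      (\<forall>\<^sub>F y in nhds x. f y = (\<Sum>k<c. h k (\<sigma> y) * e k y))" if f: "f \<in> germ_ideal x G" for f
  proof -
    obtain h where h: "\<And>k. hol_at (h k) ?p"
        "\<forall>\<^sub>F z in nhds ?p. f (\<pi> z) = (\<Sum>k<c. h k z * g k z)"
      using pull\<pi>[OF f] unfolding H by (rule germ_ideal_image_elim) auto
    have "\<forall>\<^sub>F y in nhds x. f y = (\<Sum>k<c. h k (\<sigma> y) * e k y)"
      using eventually_compose_nhds[OF isCont_vec[OF \<sigma>] h(2)] by (simp add: \<pi>\<sigma> e_def)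
    with h show ?thesis by blast
  qed
  show ?thesis
  proof (rule smooth_at_criterion)
    show "hol_at (e k) x" if "k < c" for k using eG[OF that] by (rule germ_ideal_hol)
    show "e k x = 0" if "k < c" for k using that g by (simp add: e_def)
    show "germ_ideal x G = germ_ideal x (e ` {..<c})"
    proof (rule equalityI; rule germ_ideal_mono)
      fix f assume f: "f \<in> G"
      then have "f \<in> germ_ideal x G" using G germ_ideal_base by blast
      from expand[OF this] obtain h where h: "\<And>k. hol_at (h k) ?p"
        "\<forall>\<^sub>F y in nhds x. f y = (\<Sum>k<c. h k (\<sigma> y) * e k y)" by blast
      show "f \<in> germ_ideal x (e ` {..<c})"
        by (rule germ_idealI[OF _ _ _ _ h(2)]) (use h(1) G f in \<open>auto intro: hol_at_compose[OF _ \<sigma>]\<close>)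
    qed (use eG in auto)
    fix f assume f: "f \<in> germ_ideal x G" and grad: "gradient f x = 0"
    from expand[OF f] obtain h where h: "\<And>k. hol_at (h k) ?p"
        "\<forall>\<^sub>F z in nhds ?p. f (\<pi> z) = (\<Sum>k<c. h k z * g k z)"
        "\<forall>\<^sub>F y in nhds x. f y = (\<Sum>k<c. h k (\<sigma> y) * e k y)" by blast
    have "partial_deriv j (\<lambda>z. f (\<pi> z)) ?p = 0" for j
      using partial_deriv_compose[of f \<pi> ?p j] germ_ideal_hol[OF f] \<pi> grad
      by (simp add: \<pi>\<sigma> hol_at_imp_complex_differentiable_at gradient_def Finite_Cartesian_Product.vec_eq_iff)
    then have "gradient (\<lambda>z. \<Sum>k<c. h k z * g k z) ?p = 0"
      using partial_deriv_cong[OF h(2)] by (simp add: gradient_def Finite_Cartesian_Product.vec_eq_iff)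
    then have "(\<Sum>k<c. h k ?p *s gradient (g k) ?p) = 0"
      using gradient_combination[of "{..<c}" h ?p g] h g by simp
    then have "\<forall>k<c. h k ?p = 0" using ind unfolding independent_differentials_def
      by (elim allE[of _ "\<lambda>k. h k ?p"]) blast
    then show "\<exists>(L :: nat set) \<phi> \<psi>. finite L \<and>
        (\<forall>j\<in>L. hol_at (\<phi> j) x \<and> \<phi> j x = 0 \<and> \<psi> j \<in> germ_ideal x G) \<and>
        (\<forall>\<^sub>F y in nhds x. f y = (\<Sum>j\<in>L. \<phi> j y * \<psi> j y))"
      using h eG hol_at_compose[OF h(1) \<sigma>]
      by (intro exI[of _ "{..<c}"] exI[of _ "\<lambda>k y. h k (\<sigma> y)"] exI[of _ e]) auto
  qed
qed

section \<open>Minors\<close>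

text \<open>
  The size of a minor is a number and not a type, hence the use of determinants of matrices whose
  size is a parameter.
\<close>

lemma minor_eq_det:
  "minor t r s A = Determinant.det (Matrix.mat t t (\<lambda>(i, j). A $ r i $ s j))"
proof -
  let ?M = "Matrix.mat t t (\<lambda>(i, j). A $ r i $ s j)"
  have "(\<Prod>i\<in>{0..<t}. A $ r i $ s (p i)) = (\<Prod>i = 0..<t. ?M $$ (i, p i))"
    if "p permutes {0..<t}" for p
    using permutes_in_image[OF that] by (intro prod.cong) auto
  then have "(\<Sum>p | p permutes {0..<t}. of_int (sign p) * (\<Prod>i\<in>{0..<t}. A $ r i $ s (p i))) =
      (\<Sum>p | p permutes {0..<t}. of_int (sign p) * (\<Prod>i = 0..<t. ?M $$ (i, p i)))"
    by (intro sum.cong refl) simp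
  then show ?thesis
    unfolding minor_def det_def'[OF mat_carrier] lessThan_atLeast0 .
qed

lemma minor_cong:
  assumes "\<And>i j. i < t \<Longrightarrow> j < t \<Longrightarrow> A $ r i $ s j = A' $ r' i $ s' j"
  shows "minor t r s A = minor t r' s' A'"
proof -
  have "Matrix.mat t t (\<lambda>(i, j). A $ r i $ s j) = Matrix.mat t t (\<lambda>(i, j). A' $ r' i $ s' j)"
    by (rule cong_mat) (simp_all add: assms)
  then show ?thesis by (simp only: minor_eq_det)
qed

lemma minor_transpose: "minor t r s A = minor t s r (transpose A)"
proof -
  have "Matrix.transpose_mat (Matrix.mat t t (\<lambda>(i, j). A $ r i $ s j)) =
      Matrix.mat t t (\<lambda>(i, j). transpose A $ s i $ r j)"
    by (auto simp: Finite_Cartesian_Product.transpose_def)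
  moreover have "Determinant.det (Matrix.transpose_mat (Matrix.mat t t (\<lambda>(i, j). A $ r i $ s j))) =
      Determinant.det (Matrix.mat t t (\<lambda>(i, j). A $ r i $ s j))"
    by (rule det_transpose[of _ t]) simp
  ultimately show ?thesis by (simp only: minor_eq_det)
qed

lemma minor_equal_columns:
  assumes "i < t" "j < t" "i \<noteq> j" "s i = s j" shows "minor t r s A = 0"
  unfolding minor_eq_det
  by (rule det_identical_columns[of _ t i j]) (use assms in auto)

lemma minor_equal_rows:
  assumes "i < t" "j < t" "i \<noteq> j" "r i = r j" shows "minor t r s A = 0"
  unfolding minor_transpose[of t r s A] by (rule minor_equal_columns[OF assms])

lemma minor_nonzero_imp_inj:
  assumes "minor t r s A \<noteq> 0" shows "inj_on r {..<t}" "inj_on s {..<t}"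
  using assms minor_equal_rows[of _ t _ r s A] minor_equal_columns[of _ t _ s r A]
  unfolding inj_on_def by blast+

text \<open>
  Laplace expansion along the last column. The coefficients do not depend on \<open>s k\<close>, so for varying
  \<open>s k\<close> this is a relation between the rows of \<open>A\<close>.
\<close>

lemma minor_expand_last_column:
  "minor (Suc k) r s A =
    (\<Sum>i<k. (-1) ^ (i + k) * minor k (\<lambda>l. r (if l < i then l else Suc l)) s A * A $ r i $ s k)
      + minor k r s A * A $ r k $ s k"
proof -
  let ?M = "Matrix.mat (Suc k) (Suc k) (\<lambda>(i, j). A $ r i $ s j)"
  have del: "mat_delete ?M i k = Matrix.mat k k (\<lambda>(l, j). A $ r (if l < i then l else Suc l) $ s j)"
    if "i < Suc k" for i
    unfolding mat_delete_def by auto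
  have cof: "cofactor ?M i k = (-1) ^ (i + k) * minor k (\<lambda>l. r (if l < i then l else Suc l)) s A"
    if "i < Suc k" for i
    unfolding cofactor_def del[OF that] minor_eq_det ..
  have last: "minor k (\<lambda>l. r (if l < k then l else Suc l)) s A = minor k r s A"
    by (rule minor_cong) simp
  have "minor (Suc k) r s A = (\<Sum>i<Suc k. ?M $$ (i, k) * cofactor ?M i k)"
    unfolding minor_eq_det by (rule laplace_expansion_column) auto
  also have "\<dots> = (\<Sum>i<Suc k. (-1) ^ (i + k) * minor k (\<lambda>l. r (if l < i then l else Suc l)) s A * A $ r i $ s k)"
    by (intro sum.cong) (simp_all add: cof)
  finally show ?thesis by (simp add: last)
qed

lemma minor_nonzero_imp_trivial_kernel:
  assumes "minor t r s A \<noteq> 0" and v: "\<And>i. i < t \<Longrightarrow> (\<Sum>j<t. A $ r i $ s j * v j) = 0" and "j < t"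
  shows "v j = 0"
proof (rule ccontr)
  assume "v j \<noteq> 0"
  let ?M = "Matrix.mat t t (\<lambda>(i, j). A $ r i $ s j)"
  have "Matrix.vec t v \<noteq> 0\<^sub>v t"
    using \<open>v j \<noteq> 0\<close> \<open>j < t\<close> by (metis index_vec index_zero_vec(1))
  moreover have "?M *\<^sub>v Matrix.vec t v = 0\<^sub>v t"
    using v by (intro eq_vecI) (auto simp: scalar_prod_def lessThan_atLeast0)
  ultimately have "Determinant.det ?M = 0"
    using det_0_iff_vec_prod_zero_field[of ?M t] by (metis mat_carrier vec_carrier)
  with assms(1) show False by (simp add: minor_eq_det)
qed

lemma minor_eq_0_if_rows_dependent:
  assumes c: "\<And>j. (\<Sum>i<t. c i * A $ r i $ j) = 0" and "i < t" "c i \<noteq> 0"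
  shows "minor t r s A = 0"
proof (rule ccontr)
  assume "minor t r s A \<noteq> 0"
  then have "minor t s r (transpose A) \<noteq> 0" by (simp flip: minor_transpose)
  then have "c i = 0"
    by (rule minor_nonzero_imp_trivial_kernel)
       (use c \<open>i < t\<close> in \<open>auto simp: Finite_Cartesian_Product.transpose_def mult.commute\<close>)
  with \<open>c i \<noteq> 0\<close> show False by simp
qed

lemma rows_eq_range: "rows A = range (\<lambda>i. A $ i)"
  by (auto simp: Finite_Cartesian_Product.rows_def Finite_Cartesian_Product.row_def)

lemma minor_eq_0_if_rank_lt:
  fixes A :: "complex^'n^'m"
  assumes "rank A < t" shows "minor t r s A = 0"
proof (cases "inj_on (\<lambda>i. A $ r i) {..<t}")
  case False
  then obtain i j where ij: "i < t" "j < t" "i \<noteq> j" "A $ r i = A $ r j" unfolding inj_on_def by auto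
  show ?thesis
  proof (rule minor_eq_0_if_rows_dependent[where c = "\<lambda>l. if l = i then 1 else if l = j then -1 else 0" and i = i])
    fix b
    have "(\<Sum>l<t. (if l = i then 1 else if l = j then - 1 else 0) * A $ r l $ b) =
       (\<Sum>l<t. (if l = i then A $ r l $ b else 0) - (if l = j then A $ r l $ b else 0))"
      using ij by (intro sum.cong) auto
    also have "\<dots> = 0" using ij by (simp add: sum_subtractf)
    finally show "(\<Sum>l<t. (if l = i then 1 else if l = j then - 1 else 0) * A $ r l $ b) = 0" .
  qed (use ij in auto)
next
  case True
  let ?S = "(\<lambda>i. A $ r i) ` {..<t}"
  have "?S \<subseteq> rows A" by (auto simp: rows_eq_range)
  have "\<not> vec.independent ?S"
  proof
    assume "vec.independent ?S"
    then have "card ?S \<le> vec.dim (rows A)"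
      using \<open>?S \<subseteq> rows A\<close> by (metis vec.dim_eq_card_independent vec.dim_subset)
    then show False using assms True by (simp add: row_rank_def_gen card_image)
  qed
  then obtain u where u: "\<exists>v\<in>?S. u v \<noteq> 0" "(\<Sum>v\<in>?S. u v *s v) = 0"
    unfolding vec.dependent_finite[of ?S, simplified] by blast
  then obtain i where i: "i < t" "u (A $ r i) \<noteq> 0" by auto
  have "(\<Sum>i<t. u (A $ r i) *s A $ r i) = 0"
    using u(2) by (simp add: sum.reindex[OF True])
  then have "(\<Sum>i<t. u (A $ r i) * A $ r i $ j) = 0" for j
    by (simp add: Finite_Cartesian_Product.vec_eq_iff)
  then show ?thesis using i by (rule minor_eq_0_if_rows_dependent)
qed

lemma rank_le_if_rows_in_span:
  fixes A :: "complex^'n^'m"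
  assumes "\<And>a. A $ a \<in> vec.span ((\<lambda>i. A $ r i) ` {..<k})"
  shows "rank A \<le> k"
proof -
  have "rows A \<subseteq> vec.span ((\<lambda>i. A $ r i) ` {..<k})"
    using assms by (auto simp: rows_eq_range)
  then have "vec.dim (rows A) \<le> card ((\<lambda>i. A $ r i) ` {..<k})"
    by (rule vec.dim_le_card) simp
  also have "\<dots> \<le> k" using card_image_le[of "{..<k}"] by fastforce
  finally show ?thesis by (simp add: row_rank_def_gen)
qed

text \<open>
  If the columns in \<open>J\<close> are linearly independent, they carry a non-zero minor of size \<open>card J\<close>. Take a
  non-zero minor of the largest possible size \<open>k\<close> with columns in \<open>J\<close>. If a column \<open>b\<close> in \<open>J\<close> is left
  over, all minors obtained by bordering with \<open>b\<close> and an arbitrary row vanish; expanding them along that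
  row, that is, along the last column after transposition, gives a relation between columns in \<open>J\<close> in
  which \<open>b\<close> has the non-zero minor as its coefficient.
\<close>

lemma exists_nonzero_minor:
  fixes A :: "complex^'n^'m"
  assumes J: "\<And>v. A *v v = 0 \<Longrightarrow> (\<And>j. j \<notin> J \<Longrightarrow> v $ j = 0) \<Longrightarrow> v = 0"
  shows "\<exists>r s. s ` {..<card J} = J \<and> minor (card J) r s A \<noteq> 0"
proof -
  define P where "P k \<longleftrightarrow> (\<exists>r s. s ` {..<k} \<subseteq> J \<and> minor k r s A \<noteq> 0)" for k
  have le: "k \<le> card J" if "P k" for k
  proof -
    from that obtain r s where rs: "s ` {..<k} \<subseteq> J" "minor k r s A \<noteq> 0" unfolding P_def by blast
    then show ?thesis using card_mono[OF _ rs(1)] minor_nonzero_imp_inj(2)[OF rs(2)] by (simp add: card_image)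
  qed
  have "P 0" unfolding P_def by (simp add: minor_def)
  define k where "k = Greatest P"
  have k: "P k" "\<And>l. P l \<Longrightarrow> l \<le> k"
    unfolding k_def using GreatestI_nat[of P, OF \<open>P 0\<close>] Greatest_le_nat[of P] le by blast+
  obtain r s where rs: "s ` {..<k} \<subseteq> J" "minor k r s A \<noteq> 0" using k(1) unfolding P_def by blast
  have inj: "inj_on s {..<k}" using minor_nonzero_imp_inj(2)[OF rs(2)] .
  have "s ` {..<k} = J"
  proof (rule ccontr)
    assume "s ` {..<k} \<noteq> J"
    then obtain b where b: "b \<in> J" "b \<notin> s ` {..<k}" using rs(1) by blast
    define s' where "s' = s(k := b)"
    have s's: "s' i = s i" if "i < k" for i using that by (simp add: s'_def)
    define C where "C j = (-1) ^ (j + k) * minor k (\<lambda>l. s' (if l < j then l else Suc l)) r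
        (transpose A)" for j
    define v :: "complex^'n" where
      "v = (\<chi> c. (\<Sum>j<k. if s j = c then C j else 0) + (if b = c then minor k r s A else 0))"
    have "(A *v v) $ a = 0" for a
    proof -
      have "minor (Suc k) (r(k := a)) s' A = 0"
      proof (rule ccontr)
        assume "minor (Suc k) (r(k := a)) s' A \<noteq> 0"
        moreover have "s' ` {..<Suc k} \<subseteq> J" using rs(1) b(1) by (auto simp: s'_def less_Suc_eq)
        ultimately have "P (Suc k)" unfolding P_def by blast
        then show False using k(2) by fastforce
      qed
      then have "0 = minor (Suc k) s' (r(k := a)) (transpose A)"
        by (simp flip: minor_transpose)
      also have "\<dots> = (\<Sum>j<k. C j * A $ a $ s j) + minor k r s A * A $ a $ b"
      proof -
        have "minor k (\<lambda>l. s' (if l < j then l else Suc l)) (r(k := a)) (transpose A)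
          = minor k (\<lambda>l. s' (if l < j then l else Suc l)) r (transpose A)" for j
          by (rule minor_cong) simp
        moreover have "minor k s' (r(k := a)) (transpose A) = minor k r s A"
          unfolding minor_transpose[of k r s A] by (rule minor_cong) (simp add: s's)
        moreover have "s' k = b" by (simp add: s'_def)
        ultimately show ?thesis
          unfolding minor_expand_last_column[of k s'] C_def
          by (simp add: s's Finite_Cartesian_Product.transpose_def)
      qed
      also have "\<dots> = (A *v v) $ a"
      proof -
        have "(A *v v) $ a = (\<Sum>c\<in>UNIV. \<Sum>j<k. A $ a $ c * (if s j = c then C j else 0)) +
            (\<Sum>c\<in>UNIV. A $ a $ c * (if b = c then minor k r s A else 0))"
          unfolding v_def matrix_vector_mult_def
          by (simp add: distrib_left sum.distrib sum_distrib_left)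
        also have "(\<Sum>c\<in>UNIV. \<Sum>j<k. A $ a $ c * (if s j = c then C j else 0)) =
            (\<Sum>j<k. C j * A $ a $ s j)"
          by (subst sum.swap) (simp add: mult_delta_right mult.commute)
        also have "(\<Sum>c\<in>UNIV. A $ a $ c * (if b = c then minor k r s A else 0)) =
            minor k r s A * A $ a $ b"
          by (simp add: mult_delta_right mult.commute)
        finally show ?thesis by simp
      qed
      finally show ?thesis by simp
    qed
    then have "A *v v = 0" by (simp add: Finite_Cartesian_Product.vec_eq_iff)
    moreover have "v $ j = 0" if "j \<notin> J" for j
      using that b(1) rs(1) by (auto simp: v_def intro!: sum.neutral)
    ultimately have "v = 0" by (rule J)
    moreover have "v $ b = minor k r s A"
      using b(2) by (auto simp: v_def intro!: sum.neutral)
    ultimately show False using rs(2) by simp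
  qed
  moreover from this have "card J = k" using card_image[OF inj] by simp
  ultimately show ?thesis using rs(2) by (intro exI[of _ r] exI[of _ s]) auto
qed

text \<open>
  The rank is defined by the rows, so the previous lemma is applied to the transposed matrix and a
  set of rows that forms a basis of the row space.
\<close>

lemma exists_nonzero_minor_rank:
  fixes A :: "complex^'n^'m"
  shows "\<exists>r s. minor (rank A) r s A \<noteq> 0"
proof -
  let ?v = "\<lambda>i. A $ i"
  obtain B where B: "B \<subseteq> rows A" "vec.independent B" "rows A \<subseteq> vec.span B" "card B = vec.dim (rows A)"
    using vec.basis_exists by blast
  have "\<forall>b\<in>B. \<exists>i. ?v i = b" using B(1) by (auto simp: rows_eq_range)
  then obtain i where i: "\<And>b. b \<in> B \<Longrightarrow> ?v (i b) = b" by metis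
  have inji: "inj_on i B" using i by (metis inj_onI)
  define J where "J = i ` B"
  have cardJ: "card J = rank A" using B(4) card_image[OF inji] by (simp add: J_def row_rank_def_gen)
  have finB: "finite B" using B(2) vec.finiteI_independent by blast
  have "v = 0" if v: "transpose A *v v = 0" "\<And>j. j \<notin> J \<Longrightarrow> v $ j = 0" for v
  proof -
    have "(\<Sum>b\<in>B. v $ i b *s b) = (\<Sum>b\<in>B. v $ i b *s A $ i b)"
      using i by (intro sum.cong) auto
    also have "\<dots> = (\<Sum>j\<in>J. v $ j *s A $ j)"
      unfolding J_def by (simp add: sum.reindex[OF inji])
    also have "\<dots> = (\<Sum>j\<in>UNIV. v $ j *s A $ j)"
      by (rule sum.mono_neutral_left) (use v(2) in auto)
    also have "\<dots> = transpose A *v v"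
      by (simp add: Finite_Cartesian_Product.vec_eq_iff matrix_vector_mult_def Finite_Cartesian_Product.transpose_def mult.commute)
    finally have "(\<Sum>b\<in>B. v $ i b *s b) = 0" using v(1) by simp
    then have "\<forall>b\<in>B. v $ i b = 0"
      using B(2) unfolding vec.dependent_finite[OF finB] by (auto elim!: allE[of _ "\<lambda>b. v $ i b"])
    then have "v $ j = 0" for j using v(2)[of j] unfolding J_def by (cases "j \<in> i ` B") auto
    then show "v = 0" by (simp add: Finite_Cartesian_Product.vec_eq_iff)
  qed
  from exists_nonzero_minor[of "transpose A" J, OF this]
  obtain r s where "minor (card J) r s (transpose A) \<noteq> 0" by auto
  then show ?thesis unfolding cardJ by (metis minor_transpose)
qed

section \<open>Matrices with a non-zero minor\<close>

text \<open>
  A frame consists of \<open>k\<close> rows \<open>r 0, \<dots>\<close> and \<open>k\<close> columns \<open>s 0, \<dots>\<close>; the remaining columns form the set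
  \<open>I\<close>. On the open set where the corresponding minor, the pivot, does not vanish, all data attached to
  the kernel of a matrix of rank \<open>k\<close> can be written as rational functions of its entries, which
  make sense for neighbouring matrices of any rank.
\<close>

locale chart_frame =
  fixes k :: nat and r :: "nat \<Rightarrow> 'm::finite" and s :: "nat \<Rightarrow> 'n::finite" and I :: "'n set"
  assumes inj_r: "inj_on r {..<k}" and inj_s: "inj_on s {..<k}" and I_eq: "I = - s ` {..<k}"
begin

abbreviation pivot :: "complex^'n^'m \<Rightarrow> complex" where
  "pivot \<equiv> minor k r s"

text \<open>
  The system of equations \<open>frame_matrix A *v x = axis b 1\<close>, for \<open>b \<in> I\<close>, says that the rows \<open>r i\<close> of \<open>A\<close>
  annihilate \<open>x\<close> and that the part of \<open>x\<close> indexed by \<open>I\<close> is the unit vector at \<open>b\<close>.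
\<close>

definition frame_matrix :: "complex^'n^'m \<Rightarrow> complex^'n^'n" where
  "frame_matrix A = (\<chi> j. if j \<in> I then axis j 1 else A $ r (the_inv_into {..<k} s j))"

text \<open>
  The solution of this system by Cramer's rule. If \<open>A\<close> has rank \<open>k\<close>, these vectors form the basis of
  the kernel that is adapted to the chart \<open>I\<close>; in general only the rows \<open>r i\<close> of \<open>A\<close> annihilate them.
\<close>

definition kernel_vector :: "complex^'n^'m \<Rightarrow> 'n \<Rightarrow> complex^'n" where
  "kernel_vector A b = (\<chi> c. det (\<chi> i j. if j = c then axis b 1 $ i else frame_matrix A $ i $ j)
     / det (frame_matrix A))"

definition bordered :: "'m \<Rightarrow> 'n \<Rightarrow> complex^'n^'m \<Rightarrow> complex" where
  "bordered a b = minor (Suc k) (r(k := a)) (s(k := b))"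

text \<open>
  The columns outside \<open>I\<close> are kept, and column \<open>b \<in> I\<close> is replaced by \<open>A (e\<^sub>b - x)\<close>, where \<open>x\<close> is the
  kernel vector at \<open>b\<close>. Since \<open>e\<^sub>b - x\<close> has no component in \<open>I\<close>, this is a combination of the columns
  that are kept. It is the retraction onto the matrices of rank \<open>k\<close> given by the Schur complement.
\<close>

definition retract :: "complex^'n^'m \<Rightarrow> complex^'n^'m" where
  "retract A = (\<chi> a b. A $ a $ b - (if b \<in> I then (A *v kernel_vector A b) $ a else 0))"

definition chart_matrix :: "complex^'n^'m \<Rightarrow> complex^'n^'n" where
  "chart_matrix A = (\<chi> j i. if j \<notin> I \<and> i \<in> I then kernel_vector A i $ j else 0)"

lemma card_I: "card I = CARD('n) - k"
proof -
  have "card (s ` {..<k}) = k" using card_image[OF inj_s] by simp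
  then show ?thesis unfolding I_eq by (simp add: Compl_eq_Diff_UNIV card_Diff_subset)
qed

lemma frame_matrix_mult:
  "b \<in> I \<Longrightarrow> (frame_matrix A *v v) $ b = v $ b"
  "i < k \<Longrightarrow> (frame_matrix A *v v) $ s i = (A *v v) $ r i"
proof -
  show "(frame_matrix A *v v) $ b = v $ b" if "b \<in> I"
    using that by (simp add: frame_matrix_def matrix_vector_mult_def axis_def mult_delta_left)
  show "(frame_matrix A *v v) $ s i = (A *v v) $ r i" if "i < k"
  proof -
    have "s i \<notin> I" using that unfolding I_eq by auto
    then show ?thesis
      using that inj_s by (simp add: frame_matrix_def matrix_vector_mult_def the_inv_into_f_f)
  qed
qed

lemma eq_0_if_vanishes_on_frame:
  assumes "pivot A \<noteq> 0" and I: "\<And>b. b \<in> I \<Longrightarrow> v $ b = 0" and r: "\<And>i. i < k \<Longrightarrow> (A *v v) $ r i = 0"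
  shows "v = 0"
proof -
  have "(\<Sum>j<k. A $ r i $ s j * v $ s j) = 0" if "i < k" for i
  proof -
    have "(\<Sum>j<k. A $ r i $ s j * v $ s j) = (\<Sum>c\<in>s ` {..<k}. A $ r i $ c * v $ c)"
      by (simp add: sum.reindex[OF inj_s])
    also have "\<dots> = (A *v v) $ r i"
      unfolding matrix_vector_mult_def vec_lambda_beta
      by (rule sum.mono_neutral_left) (use I I_eq in auto)
    finally show ?thesis using r[OF that] by simp
  qed
  then have "v $ s j = 0" if "j < k" for j
    using minor_nonzero_imp_trivial_kernel[OF assms(1), of "\<lambda>j. v $ s j"] that by blast
  then have "v $ b = 0" for b using I[of b] I_eq by (cases "b \<in> I") auto
  then show ?thesis by (simp add: Finite_Cartesian_Product.vec_eq_iff)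
qed

lemma det_frame_matrix_nonzero:
  assumes "pivot A \<noteq> 0" shows "det (frame_matrix A) \<noteq> 0"
proof -
  have "v = 0" if "frame_matrix A *v v = 0" for v
    by (rule eq_0_if_vanishes_on_frame[OF assms])
       (use that frame_matrix_mult(1)[of _ A v] frame_matrix_mult(2)[of _ A v] in auto)
  then have "invertible (frame_matrix A)"
    using matrix_left_invertible_ker[of "frame_matrix A"] invertible_left_inverse[of "frame_matrix A"] by blast
  then show ?thesis by (simp add: invertible_det_nz)
qed

lemma kernel_vector:
  assumes "pivot A \<noteq> 0" "b \<in> I"
  shows "c \<in> I \<Longrightarrow> kernel_vector A b $ c = (if c = b then 1 else 0)"
    and "i < k \<Longrightarrow> (A *v kernel_vector A b) $ r i = 0"
proof -
  have *: "frame_matrix A *v kernel_vector A b = axis b 1"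
    unfolding kernel_vector_def using cramer[OF det_frame_matrix_nonzero[OF assms(1)]] by blast
  show "kernel_vector A b $ c = (if c = b then 1 else 0)" if "c \<in> I"
    using frame_matrix_mult(1)[OF that, of A "kernel_vector A b"] by (simp add: * axis_def)
  show "(A *v kernel_vector A b) $ r i = 0" if "i < k"
  proof -
    have "s i \<noteq> b" using that assms(2) I_eq by auto
    then show ?thesis
      using frame_matrix_mult(2)[OF that, of A "kernel_vector A b"] by (simp add: * axis_def)
  qed
qed

lemma matrix_vector_mult_combination:
  "A *v (\<Sum>b\<in>S. f b *s g b) = (\<Sum>b\<in>S. f b *s (A *v g b))" for A :: "complex^'n^'l" and S :: "'b set"
  by (induction S rule: infinite_finite_induct)
     (simp_all add: matrix_vector_right_distrib vector_scalar_commute)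

lemma eq_combination_of_kernel_vectors:
  assumes "pivot A \<noteq> 0" and v: "\<And>i. i < k \<Longrightarrow> (A *v v) $ r i = 0"
  shows "v = (\<Sum>b\<in>I. v $ b *s kernel_vector A b)"
proof -
  let ?w = "v - (\<Sum>b\<in>I. v $ b *s kernel_vector A b)"
  have "?w = 0"
  proof (rule eq_0_if_vanishes_on_frame[OF assms(1)])
    show "?w $ c = 0" if "c \<in> I" for c
    proof -
      have "(\<Sum>b\<in>I. v $ b * kernel_vector A b $ c) = (\<Sum>b\<in>I. if c = b then v $ b else 0)"
        using that by (intro sum.cong refl) (simp add: kernel_vector(1)[OF assms(1)])
      then show ?thesis using that by simp
    qed
    show "(A *v ?w) $ r i = 0" if "i < k" for i
      using that v kernel_vector(2)[OF assms(1)]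
      by (simp add: matrix_vector_mult_diff_distrib matrix_vector_mult_combination)
  qed
  then show ?thesis by simp
qed

lemma bordered_eq_0:
  assumes "b \<notin> I" shows "bordered a b A = 0"
proof -
  obtain j where "j < k" "b = s j" using assms unfolding I_eq by auto
  then show ?thesis
    unfolding bordered_def by (intro minor_equal_columns[of j "Suc k" k]) auto
qed

text \<open>
  Up to a combination of the rows of the frame, which does not depend on \<open>b\<close>, a bordered minor is the
  pivot times an entry of \<open>A\<close>.
\<close>

lemma bordered_expand:
  "\<exists>\<kappa>. \<forall>b. bordered a b A = (\<Sum>i<k. \<kappa> i * A $ r i $ b) + pivot A * A $ a $ b"
proof -
  let ?\<kappa> = "\<lambda>i. (-1) ^ (i + k) * minor k (\<lambda>l. (r(k := a)) (if l < i then l else Suc l)) s A"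
  have "minor k (\<lambda>l. (r(k := a)) (if l < i then l else Suc l)) (s(k := b)) A =
      minor k (\<lambda>l. (r(k := a)) (if l < i then l else Suc l)) s A" for b i
    by (rule minor_cong) simp
  moreover have "minor k (r(k := a)) (s(k := b)) A = pivot A" for b
    by (rule minor_cong) simp
  ultimately have "bordered a b A = (\<Sum>i<k. ?\<kappa> i * A $ r i $ b) + pivot A * A $ a $ b" for b
    unfolding bordered_def minor_expand_last_column by simp
  then show ?thesis by (intro exI[of _ ?\<kappa>]) simp
qed

text \<open>
  Pair the expansion of the bordered minors \<open>bordered a c A\<close>, as a function of \<open>c\<close>, with the kernel
  vector at \<open>b\<close>. On the left only \<open>c = b\<close> survives, since the bordered minors vanish for \<open>c \<notin> I\<close>. On the
  right only row \<open>a\<close> survives, since the rows of the frame annihilate the vector.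
\<close>

lemma bordered_eq:
  assumes "pivot A \<noteq> 0" "b \<in> I"
  shows "bordered a b A = pivot A * (A *v kernel_vector A b) $ a"
proof -
  let ?x = "kernel_vector A b"
  obtain \<kappa> where \<kappa>: "\<forall>b. bordered a b A = (\<Sum>i<k. \<kappa> i * A $ r i $ b) + pivot A * A $ a $ b"
    using bordered_expand[of a A] ..
  have "bordered a b A = (\<Sum>c\<in>UNIV. if c = b then bordered a c A else 0)" by simp
  also have "\<dots> = (\<Sum>c\<in>UNIV. bordered a c A * ?x $ c)"
  proof (rule sum.cong)
    fix c show "(if c = b then bordered a c A else 0) = bordered a c A * ?x $ c"
      using assms bordered_eq_0[of c a A] kernel_vector(1)[OF assms, of c] by (cases "c \<in> I") auto
  qed simp
  also have "\<dots> = (\<Sum>c\<in>UNIV. \<Sum>i<k. \<kappa> i * (A $ r i $ c * ?x $ c)) + (\<Sum>c\<in>UNIV. pivot A * (A $ a $ c * ?x $ c))"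
    by (simp add: \<kappa> distrib_right sum.distrib sum_distrib_right mult.assoc)
  also have "\<dots> = (\<Sum>i<k. \<kappa> i * (A *v ?x) $ r i) + pivot A * (A *v ?x) $ a"
    by (subst sum.swap) (simp add: sum_distrib_left matrix_vector_mult_def)
  also have "\<dots> = pivot A * (A *v ?x) $ a"
    using kernel_vector(2)[OF assms] by simp
  finally show ?thesis .
qed

lemma kernel_vector_in_kernel:
  assumes "pivot A \<noteq> 0" "b \<in> I" "rank A \<le> k"
  shows "A *v kernel_vector A b = 0"
proof -
  have "bordered a b A = 0" for a
    unfolding bordered_def by (rule minor_eq_0_if_rank_lt) (use assms(3) in simp)
  then show ?thesis
    using bordered_eq[OF assms(1,2)] assms(1) by (simp add: Finite_Cartesian_Product.vec_eq_iff)
qed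

lemma chart_matrix_in_chart_space: "chart_matrix A \<in> chart_space I"
  by (auto simp: chart_matrix_def chart_space_def)

lemma mat_kernel_eq_grass_chart:
  assumes "pivot A \<noteq> 0" "rank A \<le> k"
  shows "mat_kernel A = grass_chart I (chart_matrix A)"
proof -
  have comp: "(\<Sum>b\<in>I. v $ b *s kernel_vector A b) $ c =
      (if c \<in> I then v $ c else (\<Sum>b\<in>I. chart_matrix A $ c $ b * v $ b))" for v :: "complex^'n" and c
  proof (cases "c \<in> I")
    case True
    have "(\<Sum>b\<in>I. v $ b * kernel_vector A b $ c) = (\<Sum>b\<in>I. if c = b then v $ b else 0)"
      using True by (intro sum.cong refl) (simp add: kernel_vector(1)[OF assms(1)])
    then show ?thesis using True by simp
  next
    case False
    then show ?thesis by (simp add: chart_matrix_def mult.commute)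
  qed
  have "v \<in> mat_kernel A \<longleftrightarrow> v = (\<Sum>b\<in>I. v $ b *s kernel_vector A b)" for v
  proof
    assume "v \<in> mat_kernel A"
    then show "v = (\<Sum>b\<in>I. v $ b *s kernel_vector A b)"
      by (intro eq_combination_of_kernel_vectors[OF assms(1)]) (simp add: mat_kernel_def)
  next
    assume "v = (\<Sum>b\<in>I. v $ b *s kernel_vector A b)"
    moreover have "A *v (\<Sum>b\<in>I. v $ b *s kernel_vector A b) = 0"
      using kernel_vector_in_kernel[OF assms(1) _ assms(2)] by (simp add: matrix_vector_mult_combination)
    ultimately show "v \<in> mat_kernel A" unfolding mat_kernel_def by simp
  qed
  moreover have "v = (\<Sum>b\<in>I. v $ b *s kernel_vector A b) \<longleftrightarrow> v \<in> grass_chart I (chart_matrix A)" for v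
    unfolding Finite_Cartesian_Product.vec_eq_iff comp grass_chart_def by auto
  ultimately show ?thesis by blast
qed

lemma retract_row: "pivot A \<noteq> 0 \<Longrightarrow> i < k \<Longrightarrow> retract A $ r i = A $ r i"
  by (simp add: retract_def Finite_Cartesian_Product.vec_eq_iff kernel_vector(2))

lemma
  assumes "pivot A \<noteq> 0"
  shows pivot_retract: "pivot (retract A) = pivot A"
    and kernel_vector_retract: "kernel_vector (retract A) b = kernel_vector A b"
proof -
  show "pivot (retract A) = pivot A" by (rule minor_cong) (simp add: retract_row[OF assms])
  have "frame_matrix (retract A) = frame_matrix A"
    unfolding frame_matrix_def
  proof (intro arg_cong[of _ _ vec_lambda] ext)
    fix j
    show "(if j \<in> I then axis j 1 else retract A $ r (the_inv_into {..<k} s j)) =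
        (if j \<in> I then axis j 1 else A $ r (the_inv_into {..<k} s j))"
    proof (cases "j \<in> I")
      case False
      then obtain i where "i < k" "j = s i" using I_eq by auto
      then show ?thesis using inj_s by (simp add: the_inv_into_f_f retract_row[OF assms])
    qed simp
  qed
  then show "kernel_vector (retract A) b = kernel_vector A b" unfolding kernel_vector_def by (simp only:)
qed

text \<open>
  The retract has the same kernel vectors as \<open>A\<close>, but annihilates all of them. So its bordered minors
  vanish, and their expansions express every row by the rows of the frame.
\<close>

lemma rank_retract:
  assumes "pivot A \<noteq> 0"
  shows "rank (retract A) = k"
proof (rule antisym)
  let ?R = "retract A"
  have p: "pivot ?R \<noteq> 0" using assms by (simp add: pivot_retract)
  show "k \<le> rank ?R" using minor_eq_0_if_rank_lt[of ?R k r s] p by fastforce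
  have R0: "(?R *v kernel_vector A b) $ a = 0" if "b \<in> I" for a b
  proof -
    have "(?R *v kernel_vector A b) $ a = (A *v kernel_vector A b) $ a -
        (\<Sum>c\<in>UNIV. (if c \<in> I then (A *v kernel_vector A c) $ a else 0) * kernel_vector A b $ c)"
      by (simp add: retract_def matrix_vector_mult_def left_diff_distrib sum_subtractf)
    also have "(\<Sum>c\<in>UNIV. (if c \<in> I then (A *v kernel_vector A c) $ a else 0) * kernel_vector A b $ c) =
        (\<Sum>c\<in>UNIV. if c = b then (A *v kernel_vector A c) $ a else 0)"
      using that kernel_vector(1)[OF assms that] by (intro sum.cong) auto
    finally show ?thesis by simp
  qed
  have "bordered a b ?R = 0" for a b
    using bordered_eq[OF p] bordered_eq_0 R0 by (cases "b \<in> I") (auto simp: kernel_vector_retract[OF assms])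
  have "?R $ a \<in> vec.span ((\<lambda>i. ?R $ r i) ` {..<k})" for a
  proof -
    obtain \<kappa> where \<kappa>: "\<forall>b. bordered a b ?R = (\<Sum>i<k. \<kappa> i * ?R $ r i $ b) + pivot ?R * ?R $ a $ b"
      using bordered_expand[of a ?R] ..
    have "?R $ a $ b = (\<Sum>i<k. (- \<kappa> i / pivot ?R) * ?R $ r i $ b)" for b
    proof -
      have "pivot ?R * ?R $ a $ b = - (\<Sum>i<k. \<kappa> i * ?R $ r i $ b)"
        using \<kappa>[rule_format, of b] \<open>bordered a b ?R = 0\<close> by (simp add: eq_neg_iff_add_eq_0 add.commute)
      moreover have "?R $ a $ b = (pivot ?R * ?R $ a $ b) / pivot ?R" using p by simp
      ultimately have "?R $ a $ b = - (\<Sum>i<k. \<kappa> i * ?R $ r i $ b) / pivot ?R" by (simp only:)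
      then show ?thesis by (simp add: sum_divide_distrib sum_negf)
    qed
    then have "?R $ a = (\<Sum>i<k. (- \<kappa> i / pivot ?R) *s ?R $ r i)"
      by (simp add: Finite_Cartesian_Product.vec_eq_iff)
    also have "\<dots> \<in> vec.span ((\<lambda>i. ?R $ r i) ` {..<k})"
      by (intro vec.span_sum vec.span_scale vec.span_base) auto
    finally show ?thesis .
  qed
  then show "rank ?R \<le> k" by (rule rank_le_if_rows_in_span)
qed

lemma retract_eq_self:
  assumes "pivot A \<noteq> 0" "rank A \<le> k" shows "retract A = A"
  using kernel_vector_in_kernel[OF assms(1) _ assms(2)]
  by (simp add: retract_def Finite_Cartesian_Product.vec_eq_iff)

end

section \<open>Charts of the Grassmannian\<close>

lemma grass_chart_inj:
  assumes Z: "Z \<in> chart_space I" "Z' \<in> chart_space I" and eq: "grass_chart I Z = grass_chart I Z'"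
  shows "Z = Z'"
proof -
  have "Z $ j $ i = Z' $ j $ i" for j i
  proof (cases "j \<notin> I \<and> i \<in> I")
    case True
    define v where "v = (\<chi> c. if c \<in> I then (if c = i then 1 else 0) else Z $ c $ i)"
    have sum: "(\<Sum>b\<in>I. Y $ c $ b * v $ b) = Y $ c $ i" for Y :: "complex^'a^'a" and c
    proof -
      have "(\<Sum>b\<in>I. Y $ c $ b * v $ b) = (\<Sum>b\<in>I. if b = i then Y $ c $ b else 0)"
        by (intro sum.cong) (auto simp: v_def)
      then show ?thesis using True by simp
    qed
    have "v $ c = Z $ c $ i" if "c \<notin> I" for c using that by (simp add: v_def)
    then have "v \<in> grass_chart I Z" unfolding grass_chart_def by (simp add: sum)
    then have "v \<in> grass_chart I Z'" using eq by simp
    then have "\<forall>j. j \<notin> I \<longrightarrow> v $ j = (\<Sum>b\<in>I. Z' $ j $ b * v $ b)"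
      unfolding grass_chart_def by (rule CollectD)
    then have "v $ j = (\<Sum>b\<in>I. Z' $ j $ b * v $ b)" using True by simp
    then have "v $ j = Z' $ j $ i" by (simp only: sum)
    then show ?thesis using True by (simp add: v_def)
  next
    case False
    then show ?thesis using Z unfolding chart_space_def by auto
  qed
  then show ?thesis by (simp add: Finite_Cartesian_Product.vec_eq_iff)
qed

lemma chart_frame_exists:
  fixes A :: "complex^'n^'m"
  shows "\<exists>r s. chart_frame (rank A) r s (- s ` {..<rank A}) \<and> minor (rank A) r s A \<noteq> 0"
  using exists_nonzero_minor_rank[of A] minor_nonzero_imp_inj unfolding chart_frame_def by blast

lemma chart_frame_exists_for_chart:
  fixes A :: "complex^'n^'m"
  assumes "card I = CARD('n) - k" "k \<le> CARD('n)" "mat_kernel A = grass_chart I Z"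
  shows "\<exists>r s. chart_frame k r s I \<and> minor k r s A \<noteq> 0"
proof -
  have k: "card (- I) = k" using assms(1,2) by (simp add: Compl_eq_Diff_UNIV card_Diff_subset)
  have "v = 0" if v: "A *v v = 0" "\<And>j. j \<notin> - I \<Longrightarrow> v $ j = 0" for v
  proof -
    have "v \<in> grass_chart I Z" using v(1) assms(3) unfolding mat_kernel_def by blast
    then have "v $ j = 0" for j using v(2) unfolding grass_chart_def by (cases "j \<in> I") auto
    then show ?thesis by (simp add: Finite_Cartesian_Product.vec_eq_iff)
  qed
  from exists_nonzero_minor[of A "- I", OF this] obtain r s
    where rs: "s ` {..<k} = - I" "minor k r s A \<noteq> 0" unfolding k by blast
  then have "chart_frame k r s I"
    using minor_nonzero_imp_inj[OF rs(2)] unfolding chart_frame_def by auto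
  then show ?thesis using rs(2) by blast
qed

section \<open>Coordinates on the fibre product\<close>

lemma join_vec_nth [simp]: "join_vec a b $ Inl i = a $ i" "join_vec a b $ Inr j = b $ j"
  by (simp_all add: join_vec_def)

lemma left_part_join_vec [simp]: "left_part (join_vec a b) = a"
  by (simp add: left_part_def Finite_Cartesian_Product.vec_eq_iff)

lemma right_part_join_vec [simp]: "right_part (join_vec a b) = b"
  by (simp add: right_part_def Finite_Cartesian_Product.vec_eq_iff)

lemma unflatten_mat_flatten_mat [simp]: "unflatten_mat (flatten_mat A) = A"
  by (simp add: unflatten_mat_def flatten_mat_def Finite_Cartesian_Product.vec_eq_iff)

lemma flatten_mat_nth [simp]: "flatten_mat A $ q = A $ fst q $ snd q"
  by (simp add: flatten_mat_def)

lemma hol_at_join_vec: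
  assumes "\<And>i. hol_at (\<lambda>x. f x $ i) p" "\<And>j. hol_at (\<lambda>x. g x $ j) p"
  shows "hol_at (\<lambda>x. join_vec (f x) (g x) $ q) p"
  using assms by (cases q) simp_all

lemma hol_at_minor:
  assumes "hol_mat_at G x" shows "hol_at (\<lambda>y. minor t r s (G y)) x"
  unfolding minor_def
  by (intro hol_at_sum hol_at_mult hol_at_const hol_at_prod) (use assms in \<open>simp add: hol_mat_at_def\<close>)

lemma hol_at_det:
  fixes B :: "complex^'i \<Rightarrow> complex^'n^'n"
  assumes "\<And>i j. hol_at (\<lambda>y. B y $ i $ j) x" shows "hol_at (\<lambda>y. det (B y)) x"
  unfolding Determinants.det_def
  by (intro hol_at_sum hol_at_mult hol_at_const hol_at_prod assms)

lemma (in chart_frame) hol_at_kernel_vector: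
  assumes G: "hol_mat_at G x" and p: "pivot (G x) \<noteq> 0"
  shows "hol_at (\<lambda>y. kernel_vector (G y) b $ c) x"
proof -
  have F: "hol_at (\<lambda>y. frame_matrix (G y) $ i $ j) x" for i j
    using G by (cases "i \<in> I") (simp_all add: frame_matrix_def hol_mat_at_def)
  have "hol_at (\<lambda>y. det (\<chi> i j. if j = c then axis b 1 $ i else frame_matrix (G y) $ i $ j)) x"
  proof (rule hol_at_det)
    fix i j
    show "hol_at (\<lambda>y. (\<chi> i j. if j = c then axis b 1 $ i else frame_matrix (G y) $ i $ j) $ i $ j) x"
      using F by (cases "j = c") simp_all
  qed
  from hol_at_divide[OF this hol_at_det[OF F] det_frame_matrix_nonzero[OF p]]
  show ?thesis by (simp add: kernel_vector_def)
qed

section \<open>The Tjurina transform\<close>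

text \<open>
  The only point is that the kernels lie in the underlying set of the Grassmannian, that is, in one of
  its charts.
\<close>

lemma graph_in_tjurina_W:
  fixes A :: "complex^'n^'m"
  assumes t: "1 \<le> t" "t \<le> CARD('n)" and A: "rank A = t - 1"
  shows "(A, mat_kernel A) \<in> tjurina_W t"
proof -
  let ?S = "{(A :: complex^'n^'m, mat_kernel A) | A. A \<in> mat_lt t - mat_lt (t - 1)}"
  let ?B = "{grass_chart I ` (U \<inter> chart_space I) | (I :: 'n set) U. card I = CARD('n) - t + 1 \<and> open U}"
  have "mat_kernel A \<in> \<Union> ?B" if "A \<in> mat_lt t - mat_lt (t - 1)" for A :: "complex^'n^'m"
  proof -
    have rk: "rank A = t - 1" using that t by (auto simp: mat_lt_def)
    obtain r s where rs: "chart_frame (t - 1) r s (- s ` {..<t - 1})" "minor (t - 1) r s A \<noteq> 0"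
      using chart_frame_exists[of A] unfolding rk by blast
    let ?I = "- s ` {..<t - 1}"
    interpret chart_frame "t - 1" r s ?I by (rule rs(1))
    have "card ?I = CARD('n) - t + 1" using card_I t by simp
    then have "grass_chart ?I ` (UNIV \<inter> chart_space ?I) \<in> ?B" by blast
    moreover have "mat_kernel A \<in> grass_chart ?I ` (UNIV \<inter> chart_space ?I)"
      using mat_kernel_eq_grass_chart[OF rs(2)] chart_matrix_in_chart_space rk by auto
    ultimately show ?thesis by (rule UnionI)
  qed
  then have "?S \<subseteq> topspace (prod_topology euclidean (grass_topology (CARD('n) - t + 1)))"
    by (auto simp: grass_topology_def)
  then have "?S \<subseteq> tjurina_W t" unfolding tjurina_W_def by (rule closure_of_subset)
  moreover have "(A, mat_kernel A) \<in> ?S" using A t by (auto simp: mat_lt_def)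
  ultimately show ?thesis by blast
qed

text \<open>
  Near a point of rank \<open>t - 1\<close> the projection from the Tjurina transform is an isomorphism; its inverse
  is \<open>\<sigma> y = (y, G y, chart_matrix (G y))\<close>, and \<open>smooth_at_retract\<close> applies to \<open>\<sigma>\<close>. What has to be shown is
  that every function \<open>w\<close> vanishing on \<open>W\<close> becomes, after substitution of \<open>\<sigma>\<close>, a member of the ideal of
  the minors. Replacing \<open>G y\<close> by its retract moves the point onto \<open>W\<close> and does not change the chart
  matrix, so by Hadamard's lemma the substituted function is a combination of the entries of
  \<open>G y - retract (G y)\<close>, and these are bordered minors of \<open>G y\<close> divided by the pivot.
\<close>

lemma smooth_if_transform_smooth:
  fixes G :: "complex^'N \<Rightarrow> complex^'n^'m"
  assumes t: "1 \<le> t" "t \<le> CARD('n)" and G: "hol_mat_at G x" and rk: "rank (G x) = t - 1"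
    and smooth: "transform_smooth_at t G (x, G x, mat_kernel (G x))"
  shows "smooth_at x (germ_ideal x (pullback_minors t G))"
proof -
  define k where "k = t - 1"
  have tk: "t = Suc k" using t by (simp add: k_def)
  obtain I Z where IZ: "card I = CARD('n) - t + 1" "Z \<in> chart_space I" "mat_kernel (G x) = grass_chart I Z"
    and sm: "smooth_at (join_vec x (join_vec (flatten_mat (G x)) (flatten_mat Z)))
      (germ_ideal (join_vec x (join_vec (flatten_mat (G x)) (flatten_mat Z)))
        (transform_generators t G I (join_vec x (join_vec (flatten_mat (G x)) (flatten_mat Z)))))"
    using smooth unfolding transform_smooth_at_def by (auto simp: Let_def)
  have "card I = CARD('n) - k" "k \<le> CARD('n)" using IZ(1) t by (auto simp: k_def)
  then obtain r s where rs: "chart_frame k r s I" "minor k r s (G x) \<noteq> 0"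
    using chart_frame_exists_for_chart[of I k "G x" Z] IZ(3) by blast
  interpret chart_frame k r s I by (rule rs(1))
  have rkx: "rank (G x) \<le> k" using rk by (simp add: k_def)
  \<comment> \<open>The base point of the given chart is \<open>\<sigma> x\<close>.\<close>
  have Z: "Z = chart_matrix (G x)"
    using grass_chart_inj[OF IZ(2) chart_matrix_in_chart_space] IZ(3) mat_kernel_eq_grass_chart[OF rs(2) rkx]
    by simp
  define \<alpha> where "\<alpha> y = join_vec (flatten_mat (G y)) (flatten_mat (chart_matrix (G y)))" for y
  define \<beta> where "\<beta> y = join_vec (flatten_mat (retract (G y))) (flatten_mat (chart_matrix (G y)))" for y
  define \<sigma> where "\<sigma> y = join_vec y (\<alpha> y)" for y
  note smooth\<sigma> = sm[unfolded Z, folded \<alpha>_def, folded \<sigma>_def]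
  have hG: "hol_at (\<lambda>y. G y $ a $ b) x" for a b using G by (simp add: hol_mat_at_def)
  have hkv: "hol_at (\<lambda>y. kernel_vector (G y) b $ c) x" for b c
    by (rule hol_at_kernel_vector[OF G rs(2)])
  have hchart: "hol_at (\<lambda>y. flatten_mat (chart_matrix (G y)) $ q) x" for q
    using hkv by (cases "fst q \<notin> I \<and> snd q \<in> I") (auto simp: chart_matrix_def)
  have hS: "hol_at (\<lambda>y. (G y *v kernel_vector (G y) b) $ a) x" for a b
    unfolding matrix_vector_mult_def vec_lambda_beta by (intro hol_at_sum hol_at_mult hG hkv)
  have hretract: "hol_at (\<lambda>y. flatten_mat (retract (G y)) $ q) x" for q
    using hol_at_diff[OF hG hS] hG by (cases "snd q \<in> I") (auto simp: retract_def)
  have h\<alpha>: "hol_at (\<lambda>y. \<alpha> y $ q) x" for q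
    unfolding \<alpha>_def by (rule hol_at_join_vec[OF _ hchart]) (simp add: hG)
  have h\<beta>: "hol_at (\<lambda>y. \<beta> y $ q) x" for q
    unfolding \<beta>_def by (rule hol_at_join_vec[OF hretract hchart])
  have h\<sigma>: "hol_at (\<lambda>y. \<sigma> y $ q) x" for q
    unfolding \<sigma>_def by (rule hol_at_join_vec[OF hol_at_coord h\<alpha>])
  have \<beta>x: "\<beta> x = \<alpha> x"
    by (simp add: \<alpha>_def \<beta>_def retract_eq_self[OF rs(2) rkx])
  let ?I = "germ_ideal x (pullback_minors t G)"
  have bordered_in: "(\<lambda>y. bordered a b (G y)) \<in> ?I" for a b
  proof (cases "a \<in> r ` {..<k} \<or> b \<notin> I")
    case True
    then have "bordered a b A = 0" for A
    proof
      assume "a \<in> r ` {..<k}"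
      then obtain i where "i < k" "a = r i" by auto
      then show ?thesis unfolding bordered_def by (intro minor_equal_rows[of i "Suc k" k]) auto
    qed (rule bordered_eq_0)
    then show ?thesis by (simp add: germ_ideal_zero)
  next
    case False
    have "inj_on (r(k := a)) {..<Suc k}" "inj_on (s(k := b)) {..<Suc k}"
      using False inj_r inj_s I_eq by (auto simp: inj_on_def less_Suc_eq)
    then have "(\<lambda>y. bordered a b (G y)) \<in> pullback_minors t G"
      unfolding pullback_minors_def bordered_def tk by blast
    then show ?thesis
      by (rule germ_ideal_base) (simp add: bordered_def hol_at_minor[OF G])
  qed
  have W: "\<beta> y \<in> W_in_chart t I" if "pivot (G y) \<noteq> 0" for y
  proof -
    let ?R = "retract (G y)"
    have "chart_matrix ?R = chart_matrix (G y)"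
      unfolding chart_matrix_def kernel_vector_retract[OF that] ..
    moreover have "mat_kernel ?R = grass_chart I (chart_matrix ?R)"
      by (rule mat_kernel_eq_grass_chart) (use that in \<open>simp_all add: pivot_retract rank_retract\<close>)
    moreover have "(?R, mat_kernel ?R) \<in> tjurina_W t"
      by (rule graph_in_tjurina_W[OF t]) (use rank_retract[OF that] tk in simp)
    ultimately show ?thesis
      by (simp add: W_in_chart_def \<beta>_def chart_matrix_in_chart_space)
  qed
  have pull_W: "(\<lambda>y. w (\<alpha> y)) \<in> ?I" if w: "w \<in> W_ideal t I (\<alpha> x)" for w
  proof -
    have hw: "hol_at w (\<alpha> x)" and w0: "\<forall>\<^sub>F z in nhds (\<beta> x). z \<in> W_in_chart t I \<longrightarrow> w z = 0"
      using w unfolding \<beta>x by (simp_all add: W_ideal_def)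
    obtain h where h: "\<And>j. hol_at (h j) x"
      "\<forall>\<^sub>F y in nhds x. w (\<alpha> y) - w (\<beta> y) = (\<Sum>j\<in>UNIV. (\<alpha> y $ j - \<beta> y $ j) * h j y)"
      by (rule hadamard_lemma[OF hw h\<alpha> refl h\<beta> \<beta>x]) blast
    define c where "c q y = (if snd q \<in> I then h (Inl q) y / pivot (G y) else 0)" for q y
    have hc: "hol_at (c q) x" for q
      unfolding c_def using hol_at_divide[OF h(1) hol_at_minor[OF G] rs(2)] by (cases "snd q \<in> I") auto
    have "(\<lambda>y. \<Sum>q\<in>UNIV. c q y * bordered (fst q) (snd q) (G y)) \<in> ?I"
      by (rule germ_ideal_combination[OF finite hc bordered_in])
    moreover have "\<forall>\<^sub>F y in nhds x. (\<Sum>q\<in>UNIV. c q y * bordered (fst q) (snd q) (G y)) = w (\<alpha> y)"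
      using h(2) hol_at_imp_eventually_nonzero[OF hol_at_minor[OF G] rs(2)]
        eventually_compose_nhds[OF isCont_vec[OF h\<beta>] w0]
    proof eventually_elim
      case (elim y)
      have "w (\<alpha> y) = (\<Sum>j\<in>UNIV. (\<alpha> y $ j - \<beta> y $ j) * h j y)"
        using elim(1,3) W[OF elim(2)] by simp
      also have "\<dots> = (\<Sum>j\<in>range Inl \<union> range Inr. (\<alpha> y $ j - \<beta> y $ j) * h j y)"
        by (simp add: UNIV_sum)
      also have "\<dots> = (\<Sum>j\<in>range Inl. (\<alpha> y $ j - \<beta> y $ j) * h j y)
          + (\<Sum>j\<in>range Inr. (\<alpha> y $ j - \<beta> y $ j) * h j y)"
        by (rule sum.union_disjoint) auto
      also have "(\<Sum>j\<in>range Inr. (\<alpha> y $ j - \<beta> y $ j) * h j y) = 0"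
        by (rule sum.neutral) (auto simp: \<alpha>_def \<beta>_def)
      also have "(\<Sum>j\<in>range Inl. (\<alpha> y $ j - \<beta> y $ j) * h j y) =
          (\<Sum>q\<in>UNIV. (\<alpha> y $ Inl q - \<beta> y $ Inl q) * h (Inl q) y)"
        by (simp add: sum.reindex)
      also have "\<dots> = (\<Sum>q\<in>UNIV. c q y * bordered (fst q) (snd q) (G y))"
      proof (rule sum.cong)
        fix q :: "'m \<times> 'n"
        show "(\<alpha> y $ Inl q - \<beta> y $ Inl q) * h (Inl q) y = c q y * bordered (fst q) (snd q) (G y)"
          using elim(2) bordered_eq[OF elim(2), of "snd q" "fst q"]
          by (simp add: \<alpha>_def \<beta>_def retract_def c_def)
      qed simp
      finally show ?case by simp
    qed
    ultimately show ?thesis by (rule germ_ideal_cong)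
  qed
  show ?thesis
  proof (rule smooth_at_retract[where \<sigma> = \<sigma> and \<pi> = left_part, OF h\<sigma> _ _ _ _ _ smooth\<sigma>])
    show "hol_at (\<lambda>z. left_part z $ i) (\<sigma> x)" for i by (simp add: left_part_def)
    show "left_part (\<sigma> y) = y" for y by (simp add: \<sigma>_def)
    have hp: "hol_at g x" if "g \<in> pullback_minors t G" for g
      using that hol_at_minor[OF G] unfolding pullback_minors_def by blast
    then show "hol_at g x" if "g \<in> pullback_minors t G" for g using that .
    show "(\<lambda>z. f (left_part z)) \<in> germ_ideal (\<sigma> x) (transform_generators t G I (\<sigma> x))"
      if "f \<in> pullback_minors t G" for f
    proof (rule germ_ideal_base)
      show "(\<lambda>z. f (left_part z)) \<in> transform_generators t G I (\<sigma> x)"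
        using that unfolding transform_generators_def by blast
      show "hol_at (\<lambda>z. f (left_part z)) (\<sigma> x)"
        by (rule hol_at_compose) (use hp[OF that] in \<open>simp_all add: \<sigma>_def left_part_def[of z for z]\<close>)
    qed
    show "(\<lambda>y. f (\<sigma> y)) \<in> ?I" if f: "f \<in> transform_generators t G I (\<sigma> x)" for f
    proof -
      consider g where "g \<in> pullback_minors t G" "f = (\<lambda>y. g (left_part y))"
        | w where "w \<in> W_ideal t I (\<alpha> x)" "f = (\<lambda>y. w (right_part y))"
        | a b where "f = (\<lambda>y. unflatten_mat (left_part (right_part y)) $ a $ b - G (left_part y) $ a $ b)"
        using f unfolding transform_generators_def by (auto simp: \<sigma>_def)
      then show ?thesis
      proof cases
        case 1
        then show ?thesis using hp by (simp add: \<sigma>_def germ_ideal_base)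
      next
        case 2
        then show ?thesis using pull_W by (simp add: \<sigma>_def)
      next
        case 3
        then show ?thesis by (simp add: \<sigma>_def \<alpha>_def germ_ideal_zero)
      qed
    qed
  qed
qed

section \<open>Points of smaller rank\<close>

lemma rank_add_entry_le:
  fixes A B :: "complex^'n^'m"
  assumes "\<And>i. B $ i = A $ i + c i *s axis b 1"
  shows "rank B \<le> Suc (rank A)"
proof -
  obtain S where S: "S \<subseteq> rows A" "vec.independent S" "rows A \<subseteq> vec.span S" "card S = vec.dim (rows A)"
    using vec.basis_exists by blast
  have finS: "finite S" using S(2) vec.finiteI_independent by blast
  have "rows A \<subseteq> vec.span (insert (axis b 1) S)"
    using S(3) vec.span_mono[of S "insert (axis b 1) S"] by blast
  then have "B $ i \<in> vec.span (insert (axis b 1) S)" for i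
    unfolding assms by (intro vec.span_add vec.span_scale) (auto simp: rows_eq_range intro: vec.span_base)
  then have "vec.dim (rows B) \<le> card (insert (axis b 1) S)"
    by (intro vec.dim_le_card) (auto simp: rows_eq_range finS)
  also have "\<dots> \<le> Suc (card S)" using finS by (simp add: card_insert_if)
  finally show ?thesis using S(4) by (simp add: row_rank_def_gen)
qed

text \<open>
  Changing a single entry raises the rank by at most one, so along each coordinate line through
  \<open>G x\<close> the minor vanishes identically. The chain rule does the rest.
\<close>

lemma gradient_minor_eq_0:
  fixes G :: "complex^'N \<Rightarrow> complex^'n^'m"
  assumes G: "hol_mat_at G x" and rk: "Suc (rank (G x)) < t"
  shows "gradient (\<lambda>y. minor t r s (G y)) x = 0"
proof -
  let ?\<mu> = "\<lambda>w. minor t r s (unflatten_mat w)"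
  let ?w = "flatten_mat (G x)"
  have \<mu>: "partial_deriv q ?\<mu> ?w = 0" for q
  proof -
    obtain a b where q: "q = (a, b)" by (cases q)
    have "?\<mu> (?w + s *s axis q 1) = 0" for s
    proof (rule minor_eq_0_if_rank_lt)
      have "unflatten_mat (?w + s *s axis q 1) $ i = G x $ i + (if i = a then s else 0) *s axis b 1" for i
        by (auto simp: q unflatten_mat_def Finite_Cartesian_Product.vec_eq_iff axis_def)
      from rank_add_entry_le[OF this] show "rank (unflatten_mat (?w + s *s axis q 1)) < t"
        using rk by simp
    qed
    then show ?thesis by (simp add: partial_deriv_def)
  qed
  have "hol_mat_at unflatten_mat ?w" by (simp add: hol_mat_at_def unflatten_mat_def)
  then have "complex_differentiable_at ?\<mu> ?w"
    by (intro hol_at_imp_complex_differentiable_at hol_at_minor)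
  moreover have "complex_differentiable_at (\<lambda>y. flatten_mat (G y) $ q) x" for q
    using G by (simp add: hol_mat_at_def hol_at_imp_complex_differentiable_at)
  ultimately have "partial_deriv i (\<lambda>y. ?\<mu> (flatten_mat (G y))) x = 0" for i
    by (subst partial_deriv_compose) (simp_all add: \<mu>)
  then show ?thesis by (simp add: gradient_def Finite_Cartesian_Product.vec_eq_iff)
qed

text \<open>
  All elements of the ideal have gradient zero at \<open>x\<close>. If the ideal is generated by functions with
  independent differentials, there are therefore no generators at all, and the minors vanish near
  \<open>x\<close>.
\<close>

lemma fibre_singular_if_rank_drops:
  fixes G :: "complex^'N \<Rightarrow> complex^'n^'m"
  assumes G: "hol_mat_at G x" and rk: "Suc (rank (G x)) < t"
    and rs: "inj_on r {..<t}" "inj_on s {..<t}" and nz: "\<not> (\<forall>\<^sub>F y in nhds x. minor t r s (G y) = 0)"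
  shows "fibre_singular_at t G x"
  unfolding fibre_singular_at_def
proof
  assume "smooth_at x (germ_ideal x (pullback_minors t G))"
  then obtain c g where g: "\<And>k. k < c \<Longrightarrow> hol_at (g k) x" "independent_differentials c g x"
    and eq: "germ_ideal x (pullback_minors t G) = germ_ideal x (g ` {..<c})"
    unfolding smooth_at_def by blast
  have "(\<lambda>y. minor t r s (G y)) \<in> germ_ideal x (pullback_minors t G)"
    by (rule germ_ideal_base) (use rs in \<open>auto simp: pullback_minors_def hol_at_minor[OF G]\<close>)
  then have f: "(\<lambda>y. minor t r s (G y)) \<in> germ_ideal x (g ` {..<c})" using eq by simp
  show False
  proof (cases "c = 0")
    case True
    then show False using f nz by (auto simp: germ_ideal_def)
  next
    case False
    then have "g 0 \<in> germ_ideal x (g ` {..<c})" by (intro germ_ideal_base g(1)) auto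
    then have "g 0 \<in> germ_ideal x (pullback_minors t G)" using eq by simp
    then obtain S h where S: "finite S" "S \<subseteq> pullback_minors t G" "\<forall>g\<in>S. hol_at (h g) x"
        "\<forall>\<^sub>F y in nhds x. g 0 y = (\<Sum>g\<in>S. h g y * g y)"
      unfolding germ_ideal_def by blast
    have S': "hol_at f x \<and> f x = 0 \<and> gradient f x = 0" if "f \<in> S" for f
    proof -
      have "f \<in> pullback_minors t G" using that S(2) by blast
      then obtain r s where "f = (\<lambda>y. minor t r s (G y))"
        unfolding pullback_minors_def by auto
      then show ?thesis
        using hol_at_minor[OF G] gradient_minor_eq_0[OF G rk] minor_eq_0_if_rank_lt[of "G x" t] rk by simp
    qed
    have "gradient (g 0) x = gradient (\<lambda>y. \<Sum>g\<in>S. h g y * g y) x"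
      using partial_deriv_cong[OF S(4)] by (simp add: gradient_def)
    also have "\<dots> = (\<Sum>g\<in>S. h g x *s gradient g x)"
      by (rule gradient_combination) (use S S' in auto)
    also have "\<dots> = 0" using S' by simp
    finally have g0: "gradient (g 0) x = 0" .
    have "(\<Sum>k<c. (if k = 0 then 1 else 0) *s gradient (g k) x) = 0"
      by (rule sum.neutral) (use g0 in auto)
    with g(2) have "\<forall>k<c. (if k = 0 then 1 else 0 :: complex) = 0"
      unfolding independent_differentials_def by (elim allE[of _ "\<lambda>k. if k = 0 then 1 else 0"]) blast
    then show False using False by auto
  qed
qed

section \<open>The fibres are proper subsets\<close>

lemma larger_minors_eq_0:
  assumes "\<And>r s. minor t r s A = 0" "t \<le> k" shows "minor k r s A = 0"
  using assms(2)
proof (induction k arbitrary: r s rule: dec_induct)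
  case base
  then show ?case by (rule assms(1))
next
  case (step k)
  then show ?case by (simp add: minor_expand_last_column)
qed

lemma analytic_dim_neighbourhood:
  fixes X :: "(complex^'N) set"
  assumes "0 < \<epsilon>" "ball 0 \<epsilon> \<subseteq> X" shows "analytic_dim X 0 = CARD('N)"
proof -
  let ?D = "{d. 0 \<in> closure {z. regular_point X d z}}"
  have reg: "regular_point X (CARD('N)) z" if z: "z \<in> ball 0 \<epsilon>" for z
  proof -
    have "\<forall>\<^sub>F w in nhds z. w \<in> ball 0 \<epsilon>" by (rule eventually_nhds_in_open) (use z in auto)
    then have "\<forall>\<^sub>F w in nhds z. w \<in> X" by eventually_elim (use assms(2) in blast)
    then show ?thesis
      unfolding regular_point_def using z assms(2)
      by (intro conjI exI[of _ 0]) (auto simp: independent_differentials_def)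
  qed
  have "0 \<in> ball (0 :: complex^'N) \<epsilon>" using assms(1) by simp
  then have "CARD('N) \<in> ?D" using reg closure_subset by blast
  moreover have "d \<le> CARD('N)" if d: "d \<in> ?D" for d
  proof -
    have "{z. regular_point X d z} \<noteq> {}"
    proof
      assume "{z. regular_point X d z} = {}"
      with d show False by simp
    qed
    then show ?thesis unfolding regular_point_def by auto
  qed
  ultimately show ?thesis
    unfolding analytic_dim_def by (intro Max_eqI finite_subset[of ?D "{..CARD('N)}"]) auto
qed

text \<open>
  Otherwise the rank is less than \<open>t\<close> on a whole ball, and \<open>X\<close> has codimension zero.
\<close>

lemma exists_nonzero_minor_near_0:
  fixes F :: "complex^'N \<Rightarrow> complex^'n^'m"
  assumes F: "determinantal_singularity t F" and \<epsilon>: "0 < \<epsilon>"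
  shows "\<exists>y r s. y \<in> ball 0 \<epsilon> \<and> minor t r s (F y) \<noteq> 0"
proof (rule ccontr)
  assume no: "\<nexists>y r s. y \<in> ball 0 \<epsilon> \<and> minor t r s (F y) \<noteq> 0"
  have "ball 0 \<epsilon> \<subseteq> F -` mat_lt t"
  proof
    fix y :: "complex^'N" assume y: "y \<in> ball 0 \<epsilon>"
    have "\<not> t \<le> rank (F y)"
    proof
      assume "t \<le> rank (F y)"
      moreover have "minor t r s (F y) = 0" for r s using no y by blast
      ultimately have "minor (rank (F y)) r s (F y) = 0" for r s
        using larger_minors_eq_0 by blast
      then show False using exists_nonzero_minor_rank[of "F y"] by blast
    qed
    then show "y \<in> F -` mat_lt t" by (simp add: mat_lt_def)
  qed
  from analytic_dim_neighbourhood[OF \<epsilon> this]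
  show False using F by (simp add: determinantal_singularity_def)
qed

section \<open>Small parameters\<close>

lemma hol_mat_at_unfolding:
  assumes "hol_mat_at F x" shows "hol_mat_at (unfolding_of F \<tau> ms u) x"
proof -
  have *: "hol_at (\<lambda>y. monomial_matrix e y $ a $ b) x" for e a b
  proof -
    obtain i j \<alpha> where e: "e = (i, j, \<alpha>)" by (cases e)
    have "hol_at (\<lambda>y. \<Prod>k\<in>UNIV. y $ k ^ \<alpha> k) x" by (intro hol_at_prod hol_at_power hol_at_coord)
    then show ?thesis by (cases "a = i \<and> b = j") (auto simp: monomial_matrix_def e)
  qed
  have "hol_at (\<lambda>y. F y $ a $ b + (\<Sum>i<\<tau>. u i * monomial_matrix (ms i) y $ a $ b)) x" for a b
    by (intro hol_at_add hol_at_sum hol_at_mult hol_at_const *) (use assms in \<open>simp add: hol_mat_at_def\<close>)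
  then show ?thesis by (simp add: hol_mat_at_def unfolding_of_def lin_comb_def)
qed

lemma norm_matrix_le_sum: "norm (A :: complex^'n^'m) \<le> (\<Sum>a\<in>UNIV. \<Sum>b\<in>UNIV. norm (A $ a $ b))"
proof -
  have "norm A \<le> (\<Sum>a\<in>UNIV. norm (A $ a))" unfolding norm_vec_def[of A] by (rule L2_set_le_sum) simp
  also have "\<dots> \<le> (\<Sum>a\<in>UNIV. \<Sum>b\<in>UNIV. norm (A $ a $ b))"
    unfolding norm_vec_def[of "_ $ _"] by (intro sum_mono L2_set_le_sum) simp
  finally show ?thesis .
qed

text \<open>
  Only a fixed point \<open>y\<close> is considered, where the unfolding depends continuously on the parameter. The
  identity theorem later carries the conclusion to all points of the ball, so the bound on the
  parameter need not depend on them.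
\<close>

lemma minor_nonzero_small_unfolding:
  fixes F :: "complex^'N \<Rightarrow> complex^'n^'m"
  assumes "minor t r s (F y) \<noteq> 0"
  shows "\<exists>\<delta>>0. \<forall>u\<in>base_ball \<tau> \<delta>. minor t r s (unfolding_of F \<tau> ms u y) \<noteq> 0"
proof -
  have "(minor t r s \<longlongrightarrow> minor t r s (F y)) (at (F y))"
    unfolding minor_def by (intro tendsto_intros)
  then have "\<forall>\<^sub>F A in at (F y). minor t r s A \<noteq> 0"
    using assms by (rule tendsto_imp_eventually_ne)
  then obtain \<eta> where \<eta>: "\<eta> > 0" "\<And>A. dist A (F y) < \<eta> \<Longrightarrow> minor t r s A \<noteq> 0"
    unfolding eventually_at using assms by (metis UNIV_I)
  define K where "K = (\<Sum>a\<in>UNIV. \<Sum>b\<in>UNIV. \<Sum>i<\<tau>. norm (monomial_matrix (ms i) y $ a $ b))"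
  have K: "K \<ge> 0" unfolding K_def by (intro sum_nonneg norm_ge_zero)
  \<comment> \<open>The perturbation is bounded by \<open>\<delta> * K\<close>; the summand 1 allows for \<open>K = 0\<close>.\<close>
  define \<delta> where "\<delta> = \<eta> / (K + 1)"
  have \<delta>: "\<delta> > 0" using \<eta>(1) K by (simp add: \<delta>_def)
  have "minor t r s (unfolding_of F \<tau> ms u y) \<noteq> 0" if u: "u \<in> base_ball \<tau> \<delta>" for u
  proof (rule \<eta>(2))
    let ?L = "lin_comb \<tau> u (\<lambda>i. monomial_matrix (ms i)) y"
    have ui: "norm (u i) \<le> \<delta>" if "i < \<tau>" for i
      using u member_le_L2_set[of "{..<\<tau>}" i "\<lambda>i. norm (u i)"] that by (simp add: base_ball_def)
    have "norm ?L \<le> (\<Sum>a\<in>UNIV. \<Sum>b\<in>UNIV. norm (?L $ a $ b))" by (rule norm_matrix_le_sum)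
    also have "\<dots> \<le> (\<Sum>a\<in>UNIV. \<Sum>b\<in>UNIV. \<Sum>i<\<tau>. \<delta> * norm (monomial_matrix (ms i) y $ a $ b))"
    proof (intro sum_mono)
      fix a b
      have "norm (?L $ a $ b) \<le> (\<Sum>i<\<tau>. norm (u i * monomial_matrix (ms i) y $ a $ b))"
        by (simp add: lin_comb_def norm_sum)
      also have "\<dots> \<le> (\<Sum>i<\<tau>. \<delta> * norm (monomial_matrix (ms i) y $ a $ b))"
        using ui by (intro sum_mono) (simp add: norm_mult mult_right_mono)
      finally show "norm (?L $ a $ b) \<le> (\<Sum>i<\<tau>. \<delta> * norm (monomial_matrix (ms i) y $ a $ b))" .
    qed
    also have "\<dots> = \<delta> * K" by (simp add: K_def sum_distrib_left)
    also have "\<dots> < \<eta>" using \<eta>(1) K by (simp add: \<delta>_def field_simps)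
    finally show "dist (unfolding_of F \<tau> ms u y) (F y) < \<eta>"
      by (simp add: unfolding_of_def dist_norm)
  qed
  with \<delta> show ?thesis by blast
qed

section \<open>The discriminant\<close>

lemma fibre_singular_if_rank_drops_on_ball:
  fixes G :: "complex^'N \<Rightarrow> complex^'n^'m"
  assumes G: "\<And>x. x \<in> ball 0 \<epsilon> \<Longrightarrow> hol_mat_at G x"
    and y: "y \<in> ball 0 \<epsilon>" "minor t r s (G y) \<noteq> 0"
    and x: "x \<in> ball 0 \<epsilon>" "rank (G x) < t - 1"
  shows "fibre_singular_at t G x"
proof (rule fibre_singular_if_rank_drops)
  show "\<not> (\<forall>\<^sub>F y in nhds x. minor t r s (G y) = 0)"
  proof
    assume "\<forall>\<^sub>F y in nhds x. minor t r s (G y) = 0"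
    then have "minor t r s (G y) = 0"
      using identity_theorem_ball[of \<epsilon> "\<lambda>y. minor t r s (G y)" x y] x(1) y(1) hol_at_minor[OF G]
        hol_at_imp_complex_differentiable_at by blast
    with y(2) show False by simp
  qed
qed (use G x minor_nonzero_imp_inj[OF y(2)] in auto)

text \<open>
  At a singular point of rank \<open>t - 1\<close> the kernel itself gives the point of the Tjurina transform that
  has to be singular.
\<close>

lemma discriminant_decomposition:
  fixes F :: "complex^'N \<Rightarrow> complex^'n^'m"
  assumes t: "1 \<le> t" "t \<le> CARD('n)"
    and F: "\<And>x. x \<in> ball 0 \<epsilon> \<Longrightarrow> hol_mat_at F x"
    and y: "y \<in> ball 0 \<epsilon>" "\<And>u. u \<in> base_ball \<tau> \<delta> \<Longrightarrow> minor t r s (unfolding_of F \<tau> ms u y) \<noteq> 0"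
  shows "discriminant t F \<tau> ms \<epsilon> \<delta> = discriminant_A t F \<tau> ms \<epsilon> \<delta> \<union> discriminant_B t F \<tau> ms \<epsilon> \<delta>"
proof (rule equalityI)
  show "discriminant t F \<tau> ms \<epsilon> \<delta> \<subseteq> discriminant_A t F \<tau> ms \<epsilon> \<delta> \<union> discriminant_B t F \<tau> ms \<epsilon> \<delta>"
  proof
    fix u assume "u \<in> discriminant t F \<tau> ms \<epsilon> \<delta>"
    then obtain x where u: "u \<in> base_ball \<tau> \<delta>" and x: "x \<in> fibre t \<epsilon> (unfolding_of F \<tau> ms u)"
      and sing: "fibre_singular_at t (unfolding_of F \<tau> ms u) x"
      unfolding discriminant_def by blast
    let ?G = "unfolding_of F \<tau> ms u"
    have rk: "rank (?G x) < t" and xb: "x \<in> ball 0 \<epsilon>" using x by (auto simp: fibre_def mat_lt_def)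
    show "u \<in> discriminant_A t F \<tau> ms \<epsilon> \<delta> \<union> discriminant_B t F \<tau> ms \<epsilon> \<delta>"
    proof (cases "rank (?G x) < t - 1")
      case True
      then have "u \<in> discriminant_A t F \<tau> ms \<epsilon> \<delta>" unfolding discriminant_A_def using u x by blast
      then show ?thesis ..
    next
      case False
      then have rk: "rank (?G x) = t - 1" using rk by simp
      let ?y = "(x, ?G x, mat_kernel (?G x))"
      have "?y \<in> tjurina_transform t \<epsilon> ?G"
        using x graph_in_tjurina_W[OF t rk] by (simp add: tjurina_transform_def)
      moreover have "\<not> transform_smooth_at t ?G ?y"
        using smooth_if_transform_smooth[OF t hol_mat_at_unfolding[OF F[OF xb]] rk] sing
        unfolding fibre_singular_at_def by blast
      ultimately have "\<exists>y\<in>tjurina_transform t \<epsilon> ?G. fst y = x \<and> \<not> transform_smooth_at t ?G y"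
        by (intro bexI[of _ ?y]) simp_all
      then have "u \<in> discriminant_B t F \<tau> ms \<epsilon> \<delta>" unfolding discriminant_B_def using u x sing by blast
      then show ?thesis ..
    qed
  qed
  have "discriminant_A t F \<tau> ms \<epsilon> \<delta> \<subseteq> discriminant t F \<tau> ms \<epsilon> \<delta>"
  proof
    fix u assume "u \<in> discriminant_A t F \<tau> ms \<epsilon> \<delta>"
    then obtain x where u: "u \<in> base_ball \<tau> \<delta>" and x: "x \<in> fibre t \<epsilon> (unfolding_of F \<tau> ms u)"
      and rk: "rank (unfolding_of F \<tau> ms u x) < t - 1"
      unfolding discriminant_A_def by blast
    have "x \<in> ball 0 \<epsilon>" using x by (simp add: fibre_def)
    moreover have "hol_mat_at (unfolding_of F \<tau> ms u) z" if "z \<in> ball 0 \<epsilon>" for z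
      by (rule hol_mat_at_unfolding[OF F[OF that]])
    ultimately have "fibre_singular_at t (unfolding_of F \<tau> ms u) x"
      using y(2)[OF u] rk by (intro fibre_singular_if_rank_drops_on_ball[OF _ y(1)])
    then show "u \<in> discriminant t F \<tau> ms \<epsilon> \<delta>" unfolding discriminant_def using u x by blast
  qed
  moreover have "discriminant_B t F \<tau> ms \<epsilon> \<delta> \<subseteq> discriminant t F \<tau> ms \<epsilon> \<delta>"
    unfolding discriminant_def discriminant_B_def by blast
  ultimately show "discriminant_A t F \<tau> ms \<epsilon> \<delta> \<union> discriminant_B t F \<tau> ms \<epsilon> \<delta> \<subseteq> discriminant t F \<tau> ms \<epsilon> \<delta>"
    by blast
qed

theorem proposition3p5:
  fixes F :: "complex^'N \<Rightarrow> complex^'n^'m"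
    and t \<tau> :: nat
    and ms :: "nat \<Rightarrow> 'm \<times> 'n \<times> ('N \<Rightarrow> nat)"
  assumes "CARD('m) > CARD('n)" and "CARD('n) \<ge> t" and "t \<ge> 2"
    and "determinantal_singularity t F"
    and "tjurina_number F = enat \<tau>"
    and "analytic_dim (F -` mat_lt t) 0 \<ge> CARD('m)"
    and "monomial_basis F \<tau> ms"
  shows "\<forall>\<^sub>F \<epsilon> in at_right 0. \<forall>\<^sub>F \<delta> in at_right 0.
    discriminant t F \<tau> ms \<epsilon> \<delta> = discriminant_A t F \<tau> ms \<epsilon> \<delta> \<union> discriminant_B t F \<tau> ms \<epsilon> \<delta>"
proof -
  have "\<forall>\<^sub>F x in nhds 0. hol_mat_at F x"
    using assms(4) unfolding determinantal_singularity_def hol_mat_at_def hol_at_def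
    by (simp add: eventually_all_finite eventually_eventually)
  then obtain \<epsilon>0 where \<epsilon>0: "\<epsilon>0 > 0" "\<And>x. x \<in> ball 0 \<epsilon>0 \<Longrightarrow> hol_mat_at F x"
    unfolding eventually_nhds_metric by (auto simp: dist_commute)
  have "\<forall>\<^sub>F \<delta> in at_right 0. discriminant t F \<tau> ms \<epsilon> \<delta> =
      discriminant_A t F \<tau> ms \<epsilon> \<delta> \<union> discriminant_B t F \<tau> ms \<epsilon> \<delta>" if \<epsilon>: "0 < \<epsilon>" "\<epsilon> < \<epsilon>0" for \<epsilon>
  proof -
    obtain y r s where y: "y \<in> ball 0 \<epsilon>" "minor t r s (F y) \<noteq> 0"
      using exists_nonzero_minor_near_0[OF assms(4) \<epsilon>(1)] by blast
    obtain \<delta>0 where \<delta>0: "\<delta>0 > 0" "\<And>u. u \<in> base_ball \<tau> \<delta>0 \<Longrightarrow> minor t r s (unfolding_of F \<tau> ms u y) \<noteq> 0"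
      using minor_nonzero_small_unfolding[of t r s F y \<tau> ms, OF y(2)] by blast
    have "discriminant t F \<tau> ms \<epsilon> \<delta> = discriminant_A t F \<tau> ms \<epsilon> \<delta> \<union> discriminant_B t F \<tau> ms \<epsilon> \<delta>"
      if "\<delta> < \<delta>0" for \<delta>
    proof (rule discriminant_decomposition)
      show "1 \<le> t" "t \<le> CARD('n)" using assms by auto
      show "hol_mat_at F x" if "x \<in> ball 0 \<epsilon>" for x using \<epsilon>0(2) \<epsilon> that by simp
      show "y \<in> ball 0 \<epsilon>" by (rule y(1))
      show "minor t r s (unfolding_of F \<tau> ms u y) \<noteq> 0" if "u \<in> base_ball \<tau> \<delta>" for u
        using that \<open>\<delta> < \<delta>0\<close> by (intro \<delta>0(2)) (auto simp: base_ball_def)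
    qed
    then show ?thesis
      unfolding eventually_at_right_field using \<delta>0(1) by blast
  qed
  then show ?thesis unfolding eventually_at_right_field using \<epsilon>0(1) by blast
qed

end
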